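(* There exist infinitely many graphs $H$ such that almost every $H$-free graph has no clean $H$-free profile.
   Context: All graphs are finite and simple. A graph $G$ is $H$-free if it has no induced subgraph isomorphic to $H$; $\mathrm{Forb}(H)$ denotes the family of all $H$-free graphs. For a family $\mathcal{F}$ of graphs, $\mathcal{F}^n$ is the set of graphs in $\mathcal{F}$ with vertex set $[n]=\{1,\dots,n\}$. A property $\mathcal{P}$ holds for almost all graphs in $\mathcal{F}$ if $|\mathcal{F}^n\cap\mathcal{P}|/|\mathcal{F}^n|\to 1$ as $n\to\infty$. A family of graphs is hereditary if it is closed under isomorphism and under taking induced subgraphs. A pattern $\mathfrak{F}=(\mathcal{F}_1,\dots,\mathcal{F}_k)$ is a finite sequence of hereditary families. A partition $(P_1,\dots,P_k)$ of $V(G)$ is an $\mathfrak{F}$-partition if $G[P_i]\in\mathcal{F}_i$ for all $i$; $\mathcal{P}(\mathfrak{F})$ is the family of graphs admitting an $\mathfrak{F}$-partition. A pattern $\mathfrak{F}$ is $H$-free if $H\notin\mathcal{P}(\mathfrak{F})$; it is sharply $H$-free if it is $H$-free and, for every $\mathcal{F}\in\mathfrak{F}$, every minimal graph $J\notin\mathcal{F}$ (i.e. $J\notin\mathcal{F}$ but $J\setminus v\in\mathcal{F}$ for every $v\in V(J)$) is isomorphic to a subgraph of $H$. A pattern is proper if every member contains a graph on $n$ vertices for every positive integer $n$. Let $\mathcal{H}(s,t)$ be the family of graphs whose vertex set can be partitioned into $s$ stable sets and $t$ cliques. The witnessing partition number $\chi_c(H)$ is the maximum integer $l$ such that there exist non-negative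 integers $s,t$ with $s+t=l$ and $H\notin\mathcal{H}(s,t)$. A clean $H$-free pattern is a proper, sharply $H$-free pattern $\mathfrak{F}$ with $|\mathfrak{F}|=\chi_c(H)$; it is a clean $H$-free profile for a graph $G$ if moreover $G\in\mathcal{P}(\mathfrak{F})$. *)

theory Defs
  imports Complex_Main
begin

type_synonym graph = "nat set \<times> nat set set"

definition verts :: "graph \<Rightarrow> nat set" where "verts G = fst G"
definition edges :: "graph \<Rightarrow> nat set set" where "edges G = snd G"

definition wf_graph :: "graph \<Rightarrow> bool" where
  "wf_graph G \<longleftrightarrow> finite (verts G) \<and> (\<forall>e\<in>edges G. e \<subseteq> verts G \<and> card e = 2)"

definition induced :: "graph \<Rightarrow> nat set \<Rightarrow> graph" where
  "induced G S = (S \<inter> verts G, {e\<in>edges G. e \<subseteq> S})"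

definition graph_iso :: "graph \<Rightarrow> graph \<Rightarrow> bool" where
  "graph_iso G H \<longleftrightarrow> (\<exists>f. bij_betw f (verts G) (verts H) \<and>
     (\<forall>u\<in>verts G. \<forall>v\<in>verts G. {u,v} \<in> edges G \<longleftrightarrow> {f u, f v} \<in> edges H))"

definition induced_sub :: "graph \<Rightarrow> graph \<Rightarrow> bool" where
  "induced_sub H G \<longleftrightarrow> (\<exists>S\<subseteq>verts G. graph_iso (induced G S) H)"

definition H_free :: "graph \<Rightarrow> graph \<Rightarrow> bool" where
  "H_free H G \<longleftrightarrow> \<not> induced_sub H G"

definition Forb :: "graph \<Rightarrow> graph set" where
  "Forb H = {G. wf_graph G \<and> H_free H G}"

definition graphs_on :: "nat \<Rightarrow> graph set \<Rightarrow> graph set" where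
  "graphs_on n F = {G\<in>F. verts G = {1..n}}"

definition almost_all :: "graph set \<Rightarrow> graph set \<Rightarrow> bool" where
  "almost_all F P \<longleftrightarrow>
     (\<lambda>n. real (card (graphs_on n F \<inter> P)) / real (card (graphs_on n F))) \<longlonglongrightarrow> 1"

definition hereditary :: "graph set \<Rightarrow> bool" where
  "hereditary F \<longleftrightarrow> F \<subseteq> Collect wf_graph \<and>
     (\<forall>G\<in>F. \<forall>G'. wf_graph G' \<and> graph_iso G G' \<longrightarrow> G' \<in> F) \<and>
     (\<forall>G\<in>F. \<forall>S\<subseteq>verts G. induced G S \<in> F)"

type_synonym pattern = "graph set list"

definition is_pattern :: "pattern \<Rightarrow> bool" where
  "is_pattern pat \<longleftrightarrow> (\<forall>F\<in>set pat. hereditary F)"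

definition pattern_partition :: "pattern \<Rightarrow> graph \<Rightarrow> (nat \<Rightarrow> nat) \<Rightarrow> bool" where
  "pattern_partition pat G p \<longleftrightarrow> (\<forall>v\<in>verts G. p v < length pat) \<and>
     (\<forall>i<length pat. induced G {v\<in>verts G. p v = i} \<in> pat ! i)"

definition Pat :: "pattern \<Rightarrow> graph set" where
  "Pat pat = {G. wf_graph G \<and> (\<exists>p. pattern_partition pat G p)}"

definition pattern_H_free :: "pattern \<Rightarrow> graph \<Rightarrow> bool" where
  "pattern_H_free pat H \<longleftrightarrow> H \<notin> Pat pat"

definition minimal_non_member :: "graph set \<Rightarrow> graph \<Rightarrow> bool" where
  "minimal_non_member F J \<longleftrightarrow> wf_graph J \<and> J \<notin> F \<and>
     (\<forall>v\<in>verts J. induced J (verts J - {v}) \<in> F)"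

definition sharply_H_free :: "pattern \<Rightarrow> graph \<Rightarrow> bool" where
  "sharply_H_free pat H \<longleftrightarrow> pattern_H_free pat H \<and>
     (\<forall>F\<in>set pat. \<forall>J. minimal_non_member F J \<longrightarrow> induced_sub J H)"

definition proper :: "pattern \<Rightarrow> bool" where
  "proper pat \<longleftrightarrow> (\<forall>F\<in>set pat. \<forall>n>0. \<exists>G\<in>F. card (verts G) = n)"

definition stable_set :: "graph \<Rightarrow> nat set \<Rightarrow> bool" where
  "stable_set G S \<longleftrightarrow> (\<forall>u\<in>S. \<forall>v\<in>S. {u,v} \<notin> edges G)"

definition clique_set :: "graph \<Rightarrow> nat set \<Rightarrow> bool" where
  "clique_set G S \<longleftrightarrow> (\<forall>u\<in>S. \<forall>v\<in>S. u \<noteq> v \<longrightarrow> {u,v} \<in> edges G)"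

definition in_Hst :: "nat \<Rightarrow> nat \<Rightarrow> graph \<Rightarrow> bool" where
  "in_Hst s t G \<longleftrightarrow> (\<exists>p::nat \<Rightarrow> nat. (\<forall>v\<in>verts G. p v < s + t) \<and>
     (\<forall>i<s. stable_set G {v\<in>verts G. p v = i}) \<and>
     (\<forall>i. s \<le> i \<and> i < s + t \<longrightarrow> clique_set G {v\<in>verts G. p v = i}))"

definition chi_c :: "graph \<Rightarrow> nat" where
  "chi_c H = Max {l. \<exists>s t. s + t = l \<and> \<not> in_Hst s t H}"

definition clean_pattern :: "pattern \<Rightarrow> graph \<Rightarrow> bool" where
  "clean_pattern pat H \<longleftrightarrow> is_pattern pat \<and> proper pat \<and> sharply_H_free pat H \<and>
     length pat = chi_c H"

definition clean_profile :: "pattern \<Rightarrow> graph \<Rightarrow> graph \<Rightarrow> bool" where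
  "clean_profile pat H G \<longleftrightarrow> clean_pattern pat H \<and> G \<in> Pat pat"

end

theory Submission
  imports Defs "HOL-Library.Ramsey" "HOL-Library.FuncSet" "HOL-Real_Asymp.Real_Asymp"
begin

text \<open>
  The counterexamples \<open>H\<close> are complements of sparse graphs \<open>C\<close> on \<open>2k + 2\<close> vertices with a perfect matching, where
  \<open>k\<close> is the witnessing partition number. All clean patterns consist of families containing every stable
  set, and since many small graphs can be split off \<open>C\<close> leaving a perfect matching, a graph with
  a clean profile is \<open>k\<close>-partite up to parts with fewer than four vertices and up to one part that
  induces a single edge or a spanning star. There are \<open>O(n^2 X)\<close> such graphs, where \<open>X\<close> sums
  \<open>2^(number of cross pairs)\<close> over all \<open>k\<close>-colourings of \<open>{1..n}\<close>.

  On the other hand, a \<open>k\<close>-partite graph together with one edge \<open>e\<close> in the first part and one edge \<open>f\<close> in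
  the second part is still \<open>H\<close>-free as soon as there are no edges between \<open>e\<close> and \<open>f\<close>: in the
  complement this would create a \<open>K_{2,3}\<close> in \<open>C\<close>, or else the parts are too small to cover \<open>C\<close>. No
  pattern can express such a condition across two parts, and there are \<open>\<Omega>(n^4 X)\<close> of these graphs,
  because a typical one determines its colouring up to a renaming of the colours.
\<close>

subsection \<open>Hereditary families\<close>

text \<open>The core is chosen for its four-vertex subgraphs. If four vertices of \<open>C\<close>
  are split off and the other \<open>2(k - 1)\<close> have a perfect matching, then
  \<open>k - 1\<close> stable pairs of \<open>H\<close> fill all parts but one, so the complement of
  the split-off graph occurs in no part. Eight of the eleven graphs on four vertices are excluded in
  this way. The three survivors are the edgeless graph, the single edge and the claw:
  \<open>C\<close> contains neither K4 nor a diamond, and splitting off the triangle together with a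
  vertex other than 3 strands the leaf 3. The same leaf decides the H-freeness of exotic graphs. The
  components of the core are kept apart so that no two vertices have three common neighbours, and
  the free matching edges outside the core only raise \<open>k\<close> and the order together.

  In the lower bound, each of two parts contributes about \<open>n^2\<close> choices of an edge. The
  obstacle is that one graph may be exotic for many colourings, so counting pairs of a colouring and
  a graph does not yet count graphs; this is why overlaps of colourings have to be
  estimated.\<close>

lemma verts_induced [simp]: "verts (induced G S) = S \<inter> verts G"
  by (simp add: induced_def verts_def)

lemma edges_induced [simp]: "edges (induced G S) = {e \<in> edges G. e \<subseteq> S}"
  by (simp add: induced_def edges_def)

lemma wf_induced: "wf_graph G \<Longrightarrow> wf_graph (induced G S)"
  by (auto simp: wf_graph_def)

lemma wf_graph_loop: "wf_graph G \<Longrightarrow> {v} \<notin> edges G"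
  by (force simp: wf_graph_def)

text \<open>Joins closure under induced subgraphs and under isomorphism into one
  adjacency-preserving injection, the form in which all small graphs are placed in parts.\<close>

lemma hereditary_embed:
  assumes her: "hereditary F" and G: "G \<in> F" and J: "wf_graph J"
    and inj: "inj_on f (verts J)" and sub: "f ` verts J \<subseteq> verts G"
    and adj: "\<And>u v. u \<in> verts J \<Longrightarrow> v \<in> verts J \<Longrightarrow> u \<noteq> v \<Longrightarrow> {u,v} \<in> edges J \<longleftrightarrow> {f u, f v} \<in> edges G"
  shows "J \<in> F"
proof -
  let ?S = "f ` verts J"
  let ?g = "inv_into (verts J) f"
  have wfG: "wf_graph G" using her G by (auto simp: hereditary_def)
  have IG: "induced G ?S \<in> F" using her G sub by (auto simp: hereditary_def)
  have "graph_iso (induced G ?S) J" unfolding graph_iso_def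
  proof (intro exI[of _ ?g] conjI ballI)
    have eq: "verts (induced G ?S) = ?S" using sub by auto
    show "bij_betw ?g (verts (induced G ?S)) (verts J)"
      unfolding eq using inj by (simp add: bij_betw_inv_into inj_on_imp_bij_betw)
    fix u v assume "u \<in> verts (induced G ?S)" "v \<in> verts (induced G ?S)"
    then obtain x y where xy: "x \<in> verts J" "y \<in> verts J" "u = f x" "v = f y" unfolding eq by auto
    then have g: "?g u = x" "?g v = y" using inj by auto
    have "{u,v} \<in> edges (induced G ?S) \<longleftrightarrow> {f x, f y} \<in> edges G" using xy by auto
    \<comment> \<open>The isomorphism condition includes \<open>u = v\<close>, where both sides fail
      because there are no loops.\<close>
    also have "\<dots> \<longleftrightarrow> {x,y} \<in> edges J"
      using adj[OF xy(1,2)] wf_graph_loop[OF wfG] wf_graph_loop[OF J]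
      by (cases "x = y") auto
    finally show "({u, v} \<in> edges (induced G ?S)) = ({?g u, ?g v} \<in> edges J)" using g by simp
  qed
  then show ?thesis using her IG J unfolding hereditary_def by blast
qed

lemma hereditary_edgeless:
  assumes her: "hereditary F" and G: "G \<in> F" and R: "R \<subseteq> verts G" "finite R" "indep R (edges G)"
    and J: "wf_graph J" "card (verts J) \<le> card R" "edges J = {}"
  shows "J \<in> F"
proof -
  have "finite (verts J)" using J by (auto simp: wf_graph_def)
  then obtain f where f: "inj_on f (verts J)" "f ` verts J \<subseteq> R"
    using card_le_inj[OF _ R(2) J(2)] by auto
  show ?thesis
  proof (rule hereditary_embed[OF her G J(1) f(1)])
    show "f ` verts J \<subseteq> verts G" using f R by auto
    fix u v assume "u \<in> verts J" "v \<in> verts J" "u \<noteq> v"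
    then have "f u \<in> R" "f v \<in> R" "f u \<noteq> f v" using f by (auto simp: inj_on_def)
    then show "({u, v} \<in> edges J) = ({f u, f v} \<in> edges G)" using R J by (auto simp: indep_def)
  qed
qed

lemma hereditary_complete:
  assumes her: "hereditary F" and G: "G \<in> F" and R: "R \<subseteq> verts G" "finite R" "clique R (edges G)"
    and J: "wf_graph J" "card (verts J) \<le> card R" "clique (verts J) (edges J)"
  shows "J \<in> F"
proof -
  have "finite (verts J)" using J by (auto simp: wf_graph_def)
  then obtain f where f: "inj_on f (verts J)" "f ` verts J \<subseteq> R"
    using card_le_inj[OF _ R(2) J(2)] by auto
  show ?thesis
  proof (rule hereditary_embed[OF her G J(1) f(1)])
    show "f ` verts J \<subseteq> verts G" using f R by auto
    fix u v assume uv: "u \<in> verts J" "v \<in> verts J" "u \<noteq> v"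
    then have "f u \<in> R" "f v \<in> R" "f u \<noteq> f v" using f by (auto simp: inj_on_def)
    then show "({u, v} \<in> edges J) = ({f u, f v} \<in> edges G)" using R J uv by (auto simp: clique_def)
  qed
qed

text \<open>A pattern is an ordered list, while explicit partitions number their classes in whatever
  way suits them; \<open>\<sigma>\<close> reconciles the two numberings.\<close>

lemma Pat_permuted:
  assumes wf: "wf_graph G" and q: "\<And>v. v \<in> verts G \<Longrightarrow> q v < length pat"
    and s: "bij_betw \<sigma> {..<length pat} {..<length pat}"
    and F: "\<And>i. i < length pat \<Longrightarrow> induced G {v \<in> verts G. q v = i} \<in> pat ! (\<sigma> i)"
  shows "G \<in> Pat pat"
proof -
  have "pattern_partition pat G (\<lambda>v. \<sigma> (q v))" unfolding pattern_partition_def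
  proof (intro conjI ballI allI impI)
    fix v assume "v \<in> verts G" then show "\<sigma> (q v) < length pat" using q s by (auto simp: bij_betw_def)
  next
    fix i assume "i < length pat"
    then obtain j where j: "j < length pat" "i = \<sigma> j" using s by (auto simp: bij_betw_def)
    have "{v \<in> verts G. \<sigma> (q v) = i} = {v \<in> verts G. q v = j}"
      using j q s by (auto simp: bij_betw_def inj_on_def)
    then show "induced G {v \<in> verts G. \<sigma> (q v) = i} \<in> pat ! i" using F j by simp
  qed
  then show ?thesis using wf by (auto simp: Pat_def)
qed

subsection \<open>The sparse graph and its complement\<close>

text \<open>The core consists of a triangle 0, 1, 2 with a leaf 3 at 0, a 4-cycle on 4, ..., 7, and a 5-cycle
  8, 10, 12, 13, 11 with a leaf 9 at 8. The edges outside the core join 2j and 2j + 1.\<close>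

definition core_nbrs :: "nat list list" where
  "core_nbrs = [[1,2,3],[0,2],[0,1],[0], [5,7],[4,6],[5,7],[4,6],
                [9,10,11],[8],[8,12],[8,13],[10,13],[11,12]]"

definition sparse_adj :: "nat \<Rightarrow> nat \<Rightarrow> bool" where
  "sparse_adj u v \<longleftrightarrow> (if u < 14 then v \<in> set (core_nbrs ! u) else 14 \<le> v \<and> u \<noteq> v \<and> u div 2 = v div 2)"

definition dense_graph :: "nat \<Rightarrow> graph" where
  "dense_graph m = ({..<14 + 2 * m}, {{u, v} |u v. u < 14 + 2 * m \<and> v < 14 + 2 * m \<and> u \<noteq> v \<and> \<not> sparse_adj u v})"

lemma list_all_upt14D:
  assumes "list_all P [0..<14]" "x < 14" shows "P x"
  using assms by (auto simp: list_all_iff)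

lemma core_nbrs_sym: "u < 14 \<Longrightarrow> v \<in> set (core_nbrs ! u) \<Longrightarrow> v < 14 \<and> v \<noteq> u \<and> u \<in> set (core_nbrs ! v)"
proof -
  have "list_all (\<lambda>u. list_all (\<lambda>v. v < 14 \<and> v \<noteq> u \<and> u \<in> set (core_nbrs ! v)) (core_nbrs ! u)) [0..<14]"
    unfolding core_nbrs_def by code_simp
  from list_all_upt14D[OF this] show "u < 14 \<Longrightarrow> v \<in> set (core_nbrs ! u) \<Longrightarrow> ?thesis" unfolding list_all_iff by blast
qed

lemma sparse_adj_sym: "sparse_adj u v \<Longrightarrow> sparse_adj v u"
  using core_nbrs_sym[of u v] by (cases "u < 14") (simp_all add: sparse_adj_def)

lemma sparse_adj_neq: "sparse_adj u v \<Longrightarrow> u \<noteq> v"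
  using core_nbrs_sym[of u v] by (cases "u < 14") (simp_all add: sparse_adj_def)

lemma div_2_pigeonhole:
  fixes x y z :: nat
  assumes "x div 2 = y div 2" "x div 2 = z div 2" "x \<noteq> y" "x \<noteq> z" "y \<noteq> z"
  shows False
proof -
  have "x mod 2 \<noteq> y mod 2" "x mod 2 \<noteq> z mod 2" "y mod 2 \<noteq> z mod 2"
    using assms by (metis div_mult_mod_eq)+
  then show False by (metis not_mod_2_eq_1_eq_0)
qed

lemma sparse_adj_triangle:
  assumes "sparse_adj x y" "sparse_adj y z" "sparse_adj x z" shows "{x,y,z} = {0,1,2}"
proof (cases "x < 14")
  case True
  have "list_all (\<lambda>x. list_all (\<lambda>y. list_all (\<lambda>z. z \<in> set (core_nbrs ! y) \<longrightarrow>
     (x = 0 \<or> y = 0 \<or> z = 0) \<and> (x = 1 \<or> y = 1 \<or> z = 1) \<and> (x = 2 \<or> y = 2 \<or> z = 2)) (core_nbrs ! x)) (core_nbrs ! x)) [0..<14]"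
    unfolding core_nbrs_def by code_simp
  note * = list_all_upt14D[OF this True]
  have y: "y \<in> set (core_nbrs ! x)" and z: "z \<in> set (core_nbrs ! x)" using assms True by (auto simp: sparse_adj_def)
  then have "y < 14" using core_nbrs_sym True by blast
  then have "z \<in> set (core_nbrs ! y)" using assms by (auto simp: sparse_adj_def)
  with * y z have "(x = 0 \<or> y = 0 \<or> z = 0) \<and> (x = 1 \<or> y = 1 \<or> z = 1) \<and> (x = 2 \<or> y = 2 \<or> z = 2)"
    unfolding list_all_iff by blast
  moreover have "x \<noteq> y" "y \<noteq> z" "x \<noteq> z" using assms sparse_adj_neq by blast+
  ultimately show ?thesis by (elim conjE disjE) auto
next
  case False
  then have "x div 2 = y div 2" "x div 2 = z div 2"
    using assms by (auto simp: sparse_adj_def)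
  moreover have "x \<noteq> y" "x \<noteq> z" "y \<noteq> z" using assms sparse_adj_neq by blast+
  ultimately show ?thesis using div_2_pigeonhole by blast
qed

lemma sparse_adj_leaf: "sparse_adj 3 x \<Longrightarrow> x = 0"
  by (simp add: sparse_adj_def core_nbrs_def)

text \<open>Only 0 and 8 have three neighbours, and they lie in different components of the
  core.\<close>

lemma sparse_adj_common_neighbours:
  assumes "a \<noteq> b" "sparse_adj a x" "sparse_adj a y" "sparse_adj a z" "sparse_adj b x" "sparse_adj b y" "sparse_adj b z"
    "x \<noteq> y" "x \<noteq> z" "y \<noteq> z"
  shows False
proof -
  have *: "a = 0 \<or> a = 8" if "sparse_adj a x" "sparse_adj a y" "sparse_adj a z" for a
  proof (cases "a < 14")
    case True
    have "list_all (\<lambda>a. length (core_nbrs ! a) > 2 \<longrightarrow> a = 0 \<or> a = 8) [0..<14]"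
      by (simp add: upt_rec core_nbrs_def)
    from list_all_upt14D[OF this True] have "a \<noteq> 0 \<Longrightarrow> a \<noteq> 8 \<Longrightarrow> length (core_nbrs ! a) \<le> 2" by auto
    moreover have "card {x,y,z} \<le> card (set (core_nbrs ! a))"
      using that True by (intro card_mono) (auto simp: sparse_adj_def)
    moreover have "card {x,y,z} = 3" using assms by auto
    ultimately show ?thesis using card_length[of "core_nbrs ! a"] by linarith
  next
    case False
    then have "a div 2 = x div 2" "a div 2 = y div 2" "a div 2 = z div 2"
      using that by (auto simp: sparse_adj_def)
    then show ?thesis using div_2_pigeonhole assms(8-10) by metis
  qed
  have "a = 0 \<and> b = 8 \<or> a = 8 \<and> b = 0" using * assms by metis
  then show False using assms by (auto simp: sparse_adj_def core_nbrs_def)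
qed

lemma verts_dense_graph [simp]: "verts (dense_graph m) = {..<14 + 2 * m}"
  by (simp add: dense_graph_def verts_def)

lemma edges_dense_graph: "{u,v} \<in> edges (dense_graph m) \<longleftrightarrow> u < 14 + 2 * m \<and> v < 14 + 2 * m \<and> u \<noteq> v \<and> \<not> sparse_adj u v"
  using sparse_adj_sym by (auto simp: dense_graph_def edges_def doubleton_eq_iff)

lemma wf_dense_graph: "wf_graph (dense_graph m)"
  by (auto simp: wf_graph_def dense_graph_def edges_def verts_def card_insert_if)

subsection \<open>Exotic graphs are H-free\<close>

text \<open>Three elements no two of which form \<open>e\<close> are a triangle, and there is only
  one triangle. A fourth element would produce two different triples of this kind.\<close>

lemma class_with_missing_pair:
  assumes fin: "finite X" and three: "3 \<le> card X"
    and near: "\<And>u v. u \<in> X \<Longrightarrow> v \<in> X \<Longrightarrow> u \<noteq> v \<Longrightarrow> sparse_adj u v \<or> {u,v} = e"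
  shows "X = {0,1,2} \<or> (\<exists>a b x. a \<noteq> b \<and> e = {a,b} \<and> X = {a,b,x} \<and> x \<noteq> a \<and> x \<noteq> b \<and> sparse_adj a x \<and> sparse_adj b x)"
proof -
  have tri: "{x,y,z} = {0,1,2}" if "x \<in> X" "y \<in> X" "z \<in> X" "x \<noteq> y" "y \<noteq> z" "x \<noteq> z"
    "e \<noteq> {x,y}" "e \<noteq> {y,z}" "e \<noteq> {x,z}" for x y z
  proof (rule sparse_adj_triangle)
    show "sparse_adj x y" "sparse_adj y z" "sparse_adj x z" using near[of x y] near[of y z] near[of x z] that by metis+
  qed
  show ?thesis
  proof (cases "\<exists>a b. a \<noteq> b \<and> a \<in> X \<and> b \<in> X \<and> e = {a,b}")
    case False
    then have tri': "{x,y,z} = {0,1,2}" if "x \<in> X" "y \<in> X" "z \<in> X" "x \<noteq> y" "y \<noteq> z" "x \<noteq> z" for x y z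
      using that by (intro tri) blast+
    obtain Y where Y: "Y \<subseteq> X" "card Y = 3" using three by (meson obtain_subset_with_card_n)
    then obtain x y z where xyz: "Y = {x,y,z}" "x \<noteq> y" "y \<noteq> z" "x \<noteq> z" by (auto simp: card_3_iff)
    have Y3: "{x,y,z} = {0,1,2}" using tri'[of x y z] xyz Y by simp
    have "X \<subseteq> {x,y,z}"
    proof
      fix w assume w: "w \<in> X"
      show "w \<in> {x,y,z}"
      proof (rule ccontr)
        assume "w \<notin> {x,y,z}"
        then have "{w,x,y} = {0,1,2}" using tri'[of w x y] w xyz Y by simp
        then have "w \<in> {x,y,z}" using Y3 by (metis insertI1)
        then show False using \<open>w \<notin> _\<close> by simp
      qed
    qed
    then have "X = {0,1,2}" using Y Y3 xyz by auto
    then show ?thesis ..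
  next
    case True
    then obtain a b where ab: "a \<noteq> b" "a \<in> X" "b \<in> X" "e = {a,b}" by blast
    have "X \<noteq> {a,b}" using three ab(1) by auto
    then obtain x where x: "x \<in> X" "x \<noteq> a" "x \<noteq> b" using ab by blast
    have "X \<subseteq> {a,b,x}"
    proof
      fix w assume w: "w \<in> X"
      show "w \<in> {a,b,x}"
      proof (rule ccontr)
        assume n: "w \<notin> {a,b,x}"
        have "{a,x,w} = {0,1,2}" by (rule tri) (use ab x w n in \<open>auto simp: doubleton_eq_iff\<close>)
        moreover have "{b,x,w} = {0,1,2}" by (rule tri) (use ab x w n in \<open>auto simp: doubleton_eq_iff\<close>)
        ultimately have "a \<in> {b,x,w}" by (metis insertI1)
        then show False using ab x n by simp
      qed
    qed
    then have "X = {a,b,x}" using ab x by blast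
    moreover have "sparse_adj a x" "sparse_adj b x" using near[of a x] near[of b x] ab x by (auto simp: doubleton_eq_iff)
    ultimately show ?thesis using ab x by blast
  qed
qed

text \<open>A size count: the \<open>k = 6 + m\<close> classes have to cover \<open>2k + 2\<close> vertices and have at most three
  elements each, so two of them have three. As there is no \<open>K_{2,3}\<close>, one of these is the triangle 0, 1, 2 and
  the other one contains \<open>e\<close> or \<open>f\<close>, and all remaining classes are edges; then the leaf 3 cannot be covered.\<close>

lemma no_near_proper_colouring:
  assumes p: "\<And>v. v < 14 + 2 * m \<Longrightarrow> p v < 6 + m"
    and near: "\<And>u v. u < 14 + 2 * m \<Longrightarrow> v < 14 + 2 * m \<Longrightarrow> u \<noteq> v \<Longrightarrow> p u = p v \<Longrightarrow>
      sparse_adj u v \<or> {u,v} = e \<or> {u,v} = f"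
    and ef: "\<And>u v. u \<in> e \<Longrightarrow> v \<in> f \<Longrightarrow> p u \<noteq> p v \<and> sparse_adj u v"
  shows False
proof -
  define N where "N = 14 + 2 * m"
  define k where "k = 6 + m"
  define cl where "cl i = {v. v < N \<and> p v = i}" for i
  define tri where "tri i \<longleftrightarrow> cl i = {0,1,2}" for i
  define cherry where "cherry g i \<longleftrightarrow> (\<exists>a b x. a \<noteq> b \<and> g = {a,b} \<and> cl i = {a,b,x} \<and> x \<noteq> a \<and> x \<noteq> b \<and> sparse_adj a x \<and> sparse_adj b x)" for g i
  have fin: "finite (cl i)" for i by (simp add: cl_def)
  have clE: "cl i = {0,1,2} \<or> cherry e i \<or> cherry f i" if "3 \<le> card (cl i)" for i
  proof -
    \<comment> \<open>One class cannot use both exceptional pairs, since elements of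
      \<open>e\<close> and of \<open>f\<close> have different colours.\<close>
    have "(\<forall>u\<in>cl i. \<forall>v\<in>cl i. u \<noteq> v \<longrightarrow> sparse_adj u v \<or> {u,v} = e) \<or> (\<forall>u\<in>cl i. \<forall>v\<in>cl i. u \<noteq> v \<longrightarrow> sparse_adj u v \<or> {u,v} = f)"
    proof (rule ccontr)
      assume "\<not> ?thesis"
      then obtain u v u' v' where "u \<in> cl i" "v \<in> cl i" "u \<noteq> v" "\<not> sparse_adj u v" "{u,v} \<noteq> e"
         "u' \<in> cl i" "v' \<in> cl i" "u' \<noteq> v'" "\<not> sparse_adj u' v'" "{u',v'} \<noteq> f" by blast
      then have "{u,v} = f" "{u',v'} = e" "p u = p u'" using near[of u v] near[of u' v']
        unfolding cl_def N_def mem_Collect_eq by metis+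
      moreover have "u' \<in> e" "u \<in> f" using calculation by auto
      ultimately show False using ef[of u' u] by metis
    qed
    then show ?thesis
      using class_with_missing_pair[OF fin that, of e] class_with_missing_pair[OF fin that, of f]
      unfolding cherry_def by blast
  qed
  have le3: "card (cl i) \<le> 3" for i
  proof (rule ccontr)
    assume "\<not> card (cl i) \<le> 3"
    then have "cl i = {0,1,2} \<or> cherry e i \<or> cherry f i" using clE[of i] by linarith
    then show False using \<open>\<not> card (cl i) \<le> 3\<close> unfolding cherry_def by (elim disjE exE conjE) auto
  qed
  \<comment> \<open>If \<open>h\<close> is a pair as well, the two ends of \<open>g\<close> have
    \<open>x\<close> and both ends of \<open>h\<close> as common neighbours; \<open>x\<close>
    differs from the latter by its colour.\<close>
  have nocherry: False if ch: "cherry g i" and h: "h = {c,d}" "c \<noteq> d" and gh: "(g = e \<and> h = f) \<or> (g = f \<and> h = e)" for g h i c d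
  proof -
    obtain a b x where ab: "a \<noteq> b" "g = {a,b}" "cl i = {a,b,x}" "x \<noteq> a" "x \<noteq> b" "sparse_adj a x" "sparse_adj b x"
      using ch unfolding cherry_def by blast
    have "x \<in> cl i" "a \<in> cl i" using ab(3) by simp_all
    then have 1: "p x = p a" by (simp add: cl_def)
    have 2: "sparse_adj u v \<and> p u \<noteq> p v" if "u \<in> g" "v \<in> h" for u v
      using that gh ef[of u v] ef[of v u] sparse_adj_sym[of v u] by metis
    have 3: "sparse_adj a c" "sparse_adj a d" "sparse_adj b c" "sparse_adj b d" "p a \<noteq> p c" "p a \<noteq> p d"
      using 2[of a c] 2[of a d] 2[of b c] 2[of b d] ab(2) h(1) by simp_all
    then have "x \<noteq> c" "x \<noteq> d" using 1 by auto
    with 3 ab h show False using sparse_adj_common_neighbours[of a b x c d] by simp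
  qed
  have sumN: "(\<Sum>i<k. card (cl i)) = N"
  proof -
    have "{..<N} = (\<Union>i<k. cl i)" using p by (auto simp: cl_def N_def k_def)
    moreover have "card (\<Union>i<k. cl i) = (\<Sum>i<k. card (cl i))"
      by (rule card_UN_disjoint) (auto simp: fin cl_def)
    ultimately show ?thesis by (metis card_lessThan)
  qed
  define B where "B = {i. i < k \<and> 3 \<le> card (cl i)}"
  have finB: "finite B" by (simp add: B_def)
  have N2: "N = 2 * k + 2" by (simp add: N_def k_def)
  have split: "(\<Sum>i<k. card (cl i)) = (\<Sum>i\<in>B. card (cl i)) + (\<Sum>i\<in>{..<k}-B. card (cl i))"
    by (subst add.commute, rule sum.subset_diff) (auto simp: B_def)
  have cardk: "card ({..<k} - B) = k - card B" "card B \<le> k"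
    using card_Diff_subset[OF finB, of "{..<k}"] card_mono[of "{..<k}" B] by (auto simp: B_def)
  have b3: "(\<Sum>i\<in>B. card (cl i)) \<le> 3 * card B" using sum_bounded_above[of B "\<lambda>i. card (cl i)" 3] le3 by simp
  have b2: "(\<Sum>i\<in>{..<k}-B. card (cl i)) \<le> 2 * card ({..<k} - B)"
  proof -
    have "card (cl i) \<le> 2" if "i \<in> {..<k}-B" for i using that by (auto simp: B_def)
    then show ?thesis using sum_bounded_above[of "{..<k}-B" "\<lambda>i. card (cl i)" 2] by simp
  qed
  \<comment> \<open>The classes in \<open>B\<close> have at most 3 elements and the others at most
    2, so \<open>2k + 2 \<le> 2k + card B\<close>.\<close>
  have cB: "2 \<le> card B" using split sumN N2 b3 b2 cardk by linarith
  have utri: "i = p 0" if "tri i" for i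
  proof -
    have "0 \<in> cl i" using that by (simp add: tri_def)
    then show ?thesis by (simp add: cl_def)
  qed
  have cherryD: "g \<noteq> {}" "g \<subseteq> cl i" if "cherry g i" for g i
    using that unfolding cherry_def by (elim exE conjE, simp)+
  have ucherry: "i = j" if "cherry g i" "cherry g j" for g i j
    using cherryD[OF that(1)] cherryD[OF that(2)] by (auto simp: cl_def)
  have Btype: "tri i \<or> cherry e i \<or> cherry f i" if "i \<in> B" for i using clE that by (auto simp: B_def tri_def)
  obtain g h j where g: "cherry g j" "(g = e \<and> h = f) \<or> (g = f \<and> h = e)" "j \<in> B"
  proof -
    have "\<not> B \<subseteq> {p 0}" using cB card_mono[of "{p 0}" B] by auto
    then obtain j where j: "j \<in> B" "j \<noteq> p 0" by blast
    then have "cherry e j \<or> cherry f j" using Btype utri by blast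
    then show ?thesis using that[of e j f] that[of f j e] j by blast
  qed
  have noh: "\<not> (\<exists>c d. c \<noteq> d \<and> h = {c,d})" using nocherry g by blast
  have Bsub: "B \<subseteq> {p 0, j}"
  proof
    fix i assume "i \<in> B"
    moreover have "\<not> cherry h i" using noh unfolding cherry_def by blast
    ultimately have "tri i \<or> cherry g i" using Btype[of i] g(2) by metis
    then show "i \<in> {p 0, j}" using utri ucherry g by blast
  qed
  have pj: "p 0 \<noteq> j" using Bsub cB card_mono[of "{j}" B] by auto
  have Beq: "B = {p 0, j}" using card_seteq[OF _ Bsub] cB pj by simp
  then have cB2: "card B = 2" using pj by simp
  have "\<not> cherry g (p 0)" using ucherry g pj by blast
  moreover have "\<not> cherry h (p 0)" using noh unfolding cherry_def by metis
  ultimately have tri0: "cl (p 0) = {0,1,2}" using Btype[of "p 0"] Beq g(2) unfolding tri_def by (metis insertI1)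
  have two: "card (cl i) = 2" if "i < k" "i \<notin> B" for i
  proof (rule ccontr)
    assume "card (cl i) \<noteq> 2"
    moreover have le2: "card (cl j) \<le> 2" if "j \<in> {..<k}-B" for j using that by (auto simp: B_def)
    ultimately have "card (cl i) < 2" using that by force
    then have "(\<Sum>i\<in>{..<k}-B. card (cl i)) < (\<Sum>i\<in>{..<k}-B. 2)"
      using le2 that by (intro sum_strict_mono_ex1) auto
    then show False using split sumN N2 b3 cardk cB2 by simp
  qed
  have N3: "3 < N" "0 < N" by (auto simp: N_def)
  define i where "i = p 3"
  have i: "i < k" using p[of 3] by (simp add: i_def k_def)
  have in3: "3 \<in> cl i" using N3 by (simp add: cl_def i_def)
  then have "i \<noteq> p 0" using tri0 by auto
  have "\<exists>y\<in>cl i. sparse_adj 3 y"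
  proof (cases "i = j")
    case True
    obtain a b x where "cl j = {a,b,x}" "sparse_adj a x" "sparse_adj b x" using g(1) unfolding cherry_def by metis
    then show ?thesis using in3 True sparse_adj_sym by auto
  next
    case False
    then have "card (cl i) = 2" using two i Beq \<open>i \<noteq> p 0\<close> by auto
    then obtain y where y: "cl i = {3,y}" "y \<noteq> 3" using in3 by (metis card_2_iff doubleton_eq_iff insertE singletonD)
    then have yN: "y < N" "p y = p 3" by (auto simp: cl_def i_def)
    then have "sparse_adj 3 y \<or> {3,y} = e \<or> {3,y} = f" using near[of 3 y] y N3 by (auto simp: N_def)
    moreover have "{3,y} \<noteq> h" using noh y by blast
    moreover have "{3,y} \<noteq> g"
    proof
      assume "{3,y} = g"
      then have "3 \<in> cl j" using cherryD(2)[OF g(1)] by auto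
      then show False using False by (simp add: cl_def i_def)
    qed
    ultimately show ?thesis using g(2) y by blast
  qed
  then show False using sparse_adj_leaf \<open>i \<noteq> p 0\<close> by (auto simp: cl_def)
qed

text \<open>A copy of \<open>H\<close> in \<open>G\<close> transports the colouring to
  \<open>C\<close>: an edge of \<open>G\<close> inside a class becomes a non-adjacent pair of
  \<open>C\<close> in one class, and the missing edges between \<open>e\<close> and \<open>f\<close>
  become edges of \<open>C\<close>.\<close>

lemma exotic_H_free:
  assumes p: "\<And>v. v \<in> verts G \<Longrightarrow> p v < 6 + m"
    and inner_pairs: "\<And>u v. u \<in> verts G \<Longrightarrow> v \<in> verts G \<Longrightarrow> u \<noteq> v \<Longrightarrow> p u = p v \<Longrightarrow> {u,v} \<in> edges G \<Longrightarrow>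
      {u,v} = e \<or> {u,v} = f"
    and ef: "\<And>u v. u \<in> e \<Longrightarrow> v \<in> f \<Longrightarrow> p u \<noteq> p v \<and> {u,v} \<notin> edges G"
  shows "H_free (dense_graph m) G"
  unfolding H_free_def induced_sub_def
proof
  assume "\<exists>S\<subseteq>verts G. graph_iso (induced G S) (dense_graph m)"
  then obtain S where S: "S \<subseteq> verts G" "graph_iso (induced G S) (dense_graph m)" by blast
  then have SV: "S \<inter> verts G = S" by blast
  obtain h where h: "bij_betw h S {..<14 + 2 * m}"
    and hadj: "\<And>u v. u \<in> S \<Longrightarrow> v \<in> S \<Longrightarrow> {u,v} \<in> edges G \<longleftrightarrow> {h u, h v} \<in> edges (dense_graph m)"
    using S(2) unfolding graph_iso_def by (auto simp: SV)
  define g where "g = inv_into S h"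
  have g: "g x \<in> S" "h (g x) = x" if "x < 14 + 2 * m" for x
    using that h unfolding g_def by (auto simp: bij_betw_def inv_into_into f_inv_into_f)
  have gh: "g (h u) = u" if "u \<in> S" for u using that h unfolding g_def by (auto simp: bij_betw_def)
  show False
  \<comment> \<open>Only the part of \<open>e\<close> and \<open>f\<close> inside the copy is
    transported. If a pair has an end outside \<open>S\<close>, its image is too small to act as an
    exceptional pair.\<close>
  proof (rule no_near_proper_colouring[of m "p \<circ> g" "h ` (e \<inter> S)" "h ` (f \<inter> S)"])
    fix v assume "v < 14 + 2 * m" then show "(p \<circ> g) v < 6 + m" using p g S by auto
  next
    fix u v assume *: "u < 14 + 2 * m" "v < 14 + 2 * m" "u \<noteq> v" "(p \<circ> g) u = (p \<circ> g) v"
    have guv: "g u \<noteq> g v" using g * by metis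
    show "sparse_adj u v \<or> {u,v} = h ` (e \<inter> S) \<or> {u,v} = h ` (f \<inter> S)"
    proof (cases "sparse_adj u v")
      case False
      then have "{g u, g v} \<in> edges G" using hadj g * by (simp add: edges_dense_graph)
      then have "{g u, g v} = e \<or> {g u, g v} = f" using inner_pairs[of "g u" "g v"] guv * g S by auto
      then show ?thesis using g * by auto
    qed simp
  next
    fix u v assume "u \<in> h ` (e \<inter> S)" "v \<in> h ` (f \<inter> S)"
    then obtain x y where xy: "u = h x" "v = h y" "x \<in> e" "y \<in> f" "x \<in> S" "y \<in> S" by blast
    have "p x \<noteq> p y" "{x,y} \<notin> edges G" using ef xy by auto
    then have "{u,v} \<notin> edges (dense_graph m)" "u \<noteq> v" using hadj xy gh by (auto) metis
    moreover have "u < 14 + 2 * m" "v < 14 + 2 * m" using xy h by (auto simp: bij_betw_def)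
    ultimately show "(p \<circ> g) u \<noteq> (p \<circ> g) v \<and> sparse_adj u v" using \<open>p x \<noteq> p y\<close> xy gh by (auto simp: edges_dense_graph)
  qed
qed

subsection \<open>The witnessing partition number\<close>

text \<open>Extends a choice of parts for a few classes to a permutation of all parts.\<close>

lemma bij_betw_extend:
  fixes f :: "'a \<Rightarrow> 'a"
  assumes "finite S" "A \<subseteq> S" "inj_on f A" "f ` A \<subseteq> S"
  obtains g where "bij_betw g S S" "\<And>a. a \<in> A \<Longrightarrow> g a = f a"
proof -
  have "card (S - A) = card (S - f ` A)"
    using assms by (simp add: card_Diff_subset finite_subset card_image)
  then obtain h where h: "bij_betw h (S - A) (S - f ` A)"
    using assms by (metis finite_Diff finite_same_card_bij)
  let ?g = "\<lambda>x. if x \<in> A then f x else h x"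
  have "bij_betw ?g A (f ` A)" using assms(3) by (auto simp: bij_betw_def inj_on_def)
  moreover have "bij_betw ?g (S - A) (S - f ` A)" using h by (subst bij_betw_cong[of _ _ h]) auto
  ultimately have "bij_betw ?g (A \<union> (S - A)) (f ` A \<union> (S - f ` A))"
    by (rule bij_betw_combine) auto
  moreover have "A \<union> (S - A) = S" "f ` A \<union> (S - f ` A) = S" using assms by auto
  ultimately show ?thesis using that by simp
qed

lemma not_sparse_adj_core: "u < 14 \<Longrightarrow> 14 \<le> v \<Longrightarrow> \<not> sparse_adj u v"
  using core_nbrs_sym[of u v] by (auto simp: sparse_adj_def)

lemma in_HstI:
  assumes "\<And>v. v < 14 + 2 * m \<Longrightarrow> q v < s + t"
    and "\<And>u v. u < 14 + 2 * m \<Longrightarrow> v < 14 + 2 * m \<Longrightarrow> u \<noteq> v \<Longrightarrow> q u = q v \<Longrightarrow> sparse_adj u v \<longleftrightarrow> q u < s"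
  shows "in_Hst s t (dense_graph m)"
  unfolding in_Hst_def stable_set_def clique_set_def
proof (intro exI[of _ q] conjI ballI allI impI)
  fix i u v
  assume "i < s" and uv: "u \<in> {v \<in> verts (dense_graph m). q v = i}" "v \<in> {v \<in> verts (dense_graph m). q v = i}"
  then have "u \<noteq> v \<Longrightarrow> sparse_adj u v" using assms(2)[of u v] by simp
  then show "{u, v} \<notin> edges (dense_graph m)" by (auto simp: edges_dense_graph)
next
  fix i u v
  assume "s \<le> i \<and> i < s + t" "u \<noteq> v" and uv: "u \<in> {v \<in> verts (dense_graph m). q v = i}" "v \<in> {v \<in> verts (dense_graph m). q v = i}"
  then have "\<not> sparse_adj u v" using assms(2)[of u v] by simp
  then show "{u, v} \<in> edges (dense_graph m)" using uv \<open>u \<noteq> v\<close> by (simp add: edges_dense_graph)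
qed (use assms(1) in simp)

text \<open>Colours below 50 stand for cliques of the sparse graph, colours from 50 on for stable sets.\<close>

lemma in_Hst_dense_graphI:
  assumes chk: "list_all (\<lambda>u. list_all (\<lambda>v. u \<noteq> v \<and> cs ! u = cs ! v \<longrightarrow> (v \<in> set (core_nbrs ! u)) = (cs ! u < 50)) [0..<14]) [0..<14]"
    and bnd: "list_all (\<lambda>u. cs ! u < a \<or> 50 \<le> cs ! u \<and> cs ! u < 50 + b) [0..<14]"
    and ab: "a \<le> s" "b \<le> t" "a \<le> 50"
    and ext: "\<And>v. 14 \<le> v \<Longrightarrow> v < 14 + 2 * m \<Longrightarrow> ext v < s + t \<and> a \<le> ext v"
    and sep: "\<And>u v. 14 \<le> u \<Longrightarrow> 14 \<le> v \<Longrightarrow> u < 14 + 2 * m \<Longrightarrow> v < 14 + 2 * m \<Longrightarrow> u \<noteq> v \<Longrightarrow> ext u = ext v \<Longrightarrow> u div 2 = v div 2 \<longleftrightarrow> ext u < s"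
  shows "in_Hst s t (dense_graph m)"
proof -
  \<comment> \<open>Colour \<open>50 + j\<close> of the core becomes the \<open>j\<close>-th stable
    set of \<open>C\<close>, at position \<open>s + j\<close>. Outer vertices may share these
    positions with the core, as there are no edges between them, but must avoid its cliques below
    \<open>a\<close>.\<close>
  define q where "q v = (if v < 14 then if cs ! v < 50 then cs ! v else s + (cs ! v - 50) else ext v)" for v
  have chk1: "(v \<in> set (core_nbrs ! u)) = (cs ! u < 50)" if "u < 14" "v < 14" "u \<noteq> v" "cs ! u = cs ! v" for u v
    using list_all_upt14D[OF list_all_upt14D[OF chk that(1)] that(2)] that by blast
  have bnd1: "cs ! u < a \<or> 50 \<le> cs ! u \<and> cs ! u < 50 + b" if "u < 14" for u
    using list_all_upt14D[OF bnd that] .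
  have mixed: "sparse_adj u v \<longleftrightarrow> q u < s" if "u < 14" "14 \<le> v" "v < 14 + 2 * m" "q u = q v" for u v
  proof -
    have "\<not> q u < s" using bnd1[OF that(1)] ab ext[OF that(2,3)] that by (auto simp: q_def split: if_splits)
    then show ?thesis using not_sparse_adj_core that by blast
  qed
  show ?thesis
  proof (rule in_HstI[of m q])
    fix v assume "v < 14 + 2 * m" then show "q v < s + t"
      using bnd1[of v] ext[of v] ab by (cases "v < 14") (auto simp: q_def)
  next
    fix u v assume *: "u < 14 + 2 * m" "v < 14 + 2 * m" "u \<noteq> v" "q u = q v"
    consider "u < 14" "v < 14" | "u < 14" "14 \<le> v" | "14 \<le> u" "v < 14" | "14 \<le> u" "14 \<le> v" by linarith
    then show "sparse_adj u v \<longleftrightarrow> q u < s"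
    proof cases
      case 1
      then have "cs ! u = cs ! v" using * bnd1[of u] bnd1[of v] ab by (auto simp: q_def split: if_splits)
      then have "sparse_adj u v \<longleftrightarrow> cs ! u < 50" using chk1 1 * by (auto simp: sparse_adj_def)
      also have "\<dots> \<longleftrightarrow> q u < s" using 1 bnd1[of u] ab by (auto simp: q_def)
      finally show ?thesis .
    next
      case 2 then show ?thesis using mixed * by blast
    next
      case 3 then have "sparse_adj v u \<longleftrightarrow> q v < s" using mixed * by simp
      then show ?thesis using * sparse_adj_sym[of u v] sparse_adj_sym[of v u] by auto
    next
      case 4
      then show ?thesis using sep[of u v] * by (auto simp: sparse_adj_def q_def)
    qed
  qed
qed

lemma div_2_eq_mod_2: "u \<noteq> v \<Longrightarrow> u mod 2 = v mod 2 \<Longrightarrow> u div 2 \<noteq> v div (2::nat)"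
  by (metis div_mult_mod_eq)

text \<open>The ranges cover all \<open>s + t > k\<close> and also \<open>s + t = k\<close> with
  \<open>t \<ge> 1\<close>, so \<open>(k, 0)\<close> is the only witness of size \<open>k\<close>;
  the second fact is what forces all parts to contain the stable sets. The colourings use that
  \<open>C\<close> is 3-colourable, that deleting 2 and 13 destroys its triangle and its 5-cycle and
  leaves it bipartite, that a stable set can take half of the core, and that \<open>C\<close> has a
  perfect matching.\<close>

lemma dense_graph_in_Hst:
  assumes "3 \<le> t \<or> t = 2 \<and> 2 \<le> s \<or> t = 1 \<and> 5 + m \<le> s \<or> t = 0 \<and> 7 + m \<le> s"
  shows "in_Hst s t (dense_graph m)"
  using assms
proof (elim disjE conjE)
  assume "3 \<le> t"
  then show ?thesis
    by (intro in_Hst_dense_graphI[of "[50,51,52,51,50,51,50,51,50,51,51,51,50,52]" 0 3 s t m "\<lambda>v. s + v mod 2"])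
       (auto simp: core_nbrs_def upt_rec div_2_eq_mod_2)
next
  assume "t = 2" "2 \<le> s"
  then show ?thesis
    by (intro in_Hst_dense_graphI[of "[50,51,0,51,50,51,50,51,50,51,51,51,50,1]" 2 2 s t m "\<lambda>v. s + v mod 2"])
       (auto simp: core_nbrs_def upt_rec div_2_eq_mod_2)
next
  assume t: "t = 1" "5 + m \<le> s"
  have sep: "u div 2 = v div 2 \<longleftrightarrow> (if even u then u div 2 - 2 else s) < s"
    if uv: "14 \<le> u" "14 \<le> v" "u < 14 + 2 * m" "v < 14 + 2 * m" "u \<noteq> v" and eq: "(if even u then u div 2 - 2 else s) = (if even v then v div 2 - 2 else s)" for u v
  proof -
    have d: "7 \<le> u div 2" "7 \<le> v div 2" "u div 2 < 7 + m" "v div 2 < 7 + m" using uv by linarith+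
    have "even u \<longleftrightarrow> even v" using eq d t by (auto split: if_splits)
    then have ne: "u div 2 \<noteq> v div 2" using uv div_2_eq_mod_2[of u v] by (metis even_iff_mod_2_eq_zero not_mod_2_eq_0_eq_1)
    then have "\<not> even u" using eq d \<open>even u \<longleftrightarrow> even v\<close> by auto
    then show ?thesis using ne by simp
  qed
  \<comment> \<open>The stable set takes seven core vertices and the odd end of every outer edge.
    Five cliques cover the rest of the core; each even end \<open>v\<close> is a clique by itself,
    numbered from \<open>14 div 2 - 2 = 5\<close> on.\<close>
  show ?thesis
    by (rule in_Hst_dense_graphI[of "[0,50,0,50,50,1,50,2,3,50,50,50,4,4]" 5 1 s t m "\<lambda>v. if even v then v div 2 - 2 else s"])
       (use t sep in \<open>auto simp: core_nbrs_def upt_rec\<close>)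
next
  assume "t = 0" "7 + m \<le> s"
  then show ?thesis
    by (intro in_Hst_dense_graphI[of "[0,1,1,0,2,2,3,3,4,4,5,6,5,6]" 7 0 s t m "\<lambda>v. v div 2"])
       (auto simp: core_nbrs_def upt_rec)
qed

lemma dense_graph_not_in_Hst: "\<not> in_Hst (6 + m) 0 (dense_graph m)"
proof
  assume "in_Hst (6 + m) 0 (dense_graph m)"
  then obtain p where p: "\<And>v. v < 14 + 2 * m \<Longrightarrow> p v < 6 + m"
    "\<And>i. i < 6 + m \<Longrightarrow> stable_set (dense_graph m) {v. v < 14 + 2 * m \<and> p v = i}"
    by (auto simp: in_Hst_def)
  show False
    by (rule no_near_proper_colouring[of m p "{}" "{}"])
      (use p in \<open>auto simp: stable_set_def edges_dense_graph\<close>)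
qed

lemma chi_c_dense_graph: "chi_c (dense_graph m) = 6 + m"
  unfolding chi_c_def
proof (rule Max_eqI)
  have *: "l \<le> 6 + m" if ex: "\<exists>s t. s + t = l \<and> \<not> in_Hst s t (dense_graph m)" for l
  proof (rule ccontr)
    assume "\<not> l \<le> 6 + m"
    moreover obtain s t where st: "s + t = l" "\<not> in_Hst s t (dense_graph m)" using ex by blast
    ultimately have "3 \<le> t \<or> t = 2 \<and> 2 \<le> s \<or> t = 1 \<and> 5 + m \<le> s \<or> t = 0 \<and> 7 + m \<le> s" by linarith
    then show False using dense_graph_in_Hst st by blast
  qed
  have "{l. \<exists>s t. s + t = l \<and> \<not> in_Hst s t (dense_graph m)} \<subseteq> {..6+m}"
    using * unfolding atMost_def by blast
  then show "finite {l. \<exists>s t. s + t = l \<and> \<not> in_Hst s t (dense_graph m)}"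
    by (rule finite_subset) simp
  show "l \<le> 6 + m" if "l \<in> {l. \<exists>s t. s + t = l \<and> \<not> in_Hst s t (dense_graph m)}" for l
    using * that by blast
  show "6 + m \<in> {l. \<exists>s t. s + t = l \<and> \<not> in_Hst s t (dense_graph m)}"
    using dense_graph_not_in_Hst[of m] by (intro CollectI exI[of _ "6 + m"] exI[of _ 0]) simp
qed

subsection \<open>Structure of clean patterns\<close>

locale clean_dense_pattern =
  fixes m :: nat and pat :: pattern
  assumes clean: "clean_pattern pat (dense_graph m)"
begin

lemma length_pat: "length pat = 6 + m"
  using clean by (simp add: clean_pattern_def chi_c_dense_graph)

lemma hereditary_part: "i < 6 + m \<Longrightarrow> hereditary (pat ! i)"
  using clean by (simp add: clean_pattern_def is_pattern_def length_pat)

lemma not_Pat: "dense_graph m \<notin> Pat pat"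
  using clean by (simp add: clean_pattern_def sharply_H_free_def pattern_H_free_def)

text \<open>Properness supplies a member with Ramsey-many vertices. The alternative may depend on
  \<open>n\<close>, which is harmless because only the size of the fixed graph
  \<open>dense_graph m\<close> matters.\<close>

lemma ramsey_dichotomy:
  assumes i: "i < 6 + m"
  shows "(\<forall>J. wf_graph J \<and> card (verts J) \<le> n \<and> edges J = {} \<longrightarrow> J \<in> pat ! i) \<or>
         (\<forall>J. wf_graph J \<and> card (verts J) \<le> n \<and> clique (verts J) (edges J) \<longrightarrow> J \<in> pat ! i)"
proof -
  obtain r where r: "r \<ge> 1" and ram: "\<And>(V::nat set) (E::nat set set). finite V \<Longrightarrow> card V \<ge> r \<Longrightarrow>
    \<exists>R \<subseteq> V. card R = n \<and> clique R E \<or> card R = n \<and> indep R E"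
    using ramsey2[of n n] by metis
  obtain G where G: "G \<in> pat ! i" "card (verts G) = r"
    using clean i r unfolding clean_pattern_def proper_def by (metis length_pat nth_mem One_nat_def Suc_le_eq)
  have fin: "finite (verts G)" using hereditary_part[OF i] G(1) by (auto simp: hereditary_def wf_graph_def)
  then obtain R where R: "R \<subseteq> verts G" "card R = n" "clique R (edges G) \<or> indep R (edges G)"
    using ram[of "verts G" "edges G"] G(2) by auto
  have "finite R" using R(1) fin by (rule finite_subset)
  then show ?thesis using R(3) hereditary_edgeless[OF hereditary_part[OF i] G(1) R(1)] hereditary_complete[OF hereditary_part[OF i] G(1) R(1)]
    unfolding R(2) by blast
qed

lemma induced_edgeless:
  assumes "wf_graph G" "\<And>u v. u \<in> S \<Longrightarrow> v \<in> S \<Longrightarrow> u \<noteq> v \<Longrightarrow> {u,v} \<notin> edges G"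
  shows "edges (induced G S) = {}"
  using assms by (auto simp: wf_graph_def card_2_iff)

text \<open>By Ramsey's theorem every member of the pattern contains all stable sets or all cliques. If cliques
  occurred, the corresponding \<open>H(s,t)\<close> with \<open>t \<ge> 1\<close> would contain the dense graph.\<close>

lemma edgeless_mem:
  assumes i: "i < 6 + m" and J: "wf_graph J" "card (verts J) \<le> 14 + 2 * m" "edges J = {}"
  shows "J \<in> pat ! i"
proof -
  let ?N = "14 + 2 * m" and ?k = "6 + m"
  define st where "st j \<longleftrightarrow> (\<forall>J. wf_graph J \<and> card (verts J) \<le> ?N \<and> edges J = {} \<longrightarrow> J \<in> pat ! j)" for j
  define I where "I = {j. j < ?k \<and> \<not> st j}"
  define t where "t = card I"
  define s where "s = ?k - t"
  have finI: "finite I" and subI: "I \<subseteq> {..<?k}" by (auto simp: I_def)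
  have tk: "t \<le> ?k" unfolding t_def using card_mono[OF _ subI] by simp
  have "I = {}"
  proof (rule ccontr)
    assume "I \<noteq> {}"
    then have t1: "1 \<le> t" using finI by (simp add: t_def Suc_le_eq card_gt_0_iff)
    \<comment> \<open>Here \<open>s + t = k\<close> and \<open>t \<ge> 1\<close>, the case in which
      a partition exists although \<open>k\<close> is the witnessing partition number.\<close>
    have "in_Hst s t (dense_graph m)"
      by (rule dense_graph_in_Hst) (use t1 tk in \<open>auto simp: s_def\<close>)
    then obtain p where p: "\<forall>v\<in>verts (dense_graph m). p v < s + t"
      "\<forall>i<s. stable_set (dense_graph m) {v \<in> verts (dense_graph m). p v = i}"
      "\<forall>i. s \<le> i \<and> i < s + t \<longrightarrow> clique_set (dense_graph m) {v \<in> verts (dense_graph m). p v = i}"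
      unfolding in_Hst_def by blast
    have st: "s + t = ?k" using tk by (simp add: s_def)
    have "card {s..<?k} = card I" using st by (simp add: t_def[symmetric])
    then obtain f where f: "bij_betw f {s..<?k} I" using finI finite_same_card_bij by blast
    have "inj_on f {s..<?k}" "f ` {s..<?k} \<subseteq> {..<?k}" "{s..<?k} \<subseteq> {..<?k}"
      using f subI by (auto simp: bij_betw_def)
    \<comment> \<open>\<open>in_Hst\<close> puts its cliques at the positions from \<open>s\<close>
      on; \<open>\<sigma>\<close> sends exactly these to \<open>I\<close>.\<close>
    then obtain \<sigma> where \<sigma>: "bij_betw \<sigma> {..<?k} {..<?k}" "\<And>j. j \<in> {s..<?k} \<Longrightarrow> \<sigma> j = f j"
      using bij_betw_extend[of "{..<?k}" "{s..<?k}" f] by (metis finite_lessThan)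
    have \<sigma>I: "\<sigma> j \<in> I \<longleftrightarrow> s \<le> j" if "j < ?k" for j
    proof
      assume "\<sigma> j \<in> I"
      then obtain l where l: "l \<in> {s..<?k}" "\<sigma> l = \<sigma> j" using f \<sigma>(2) by (metis bij_betw_imp_surj_on imageE)
      then have "l = j" using \<sigma>(1) that by (auto simp: bij_betw_def inj_on_def)
      then show "s \<le> j" using l by simp
    next
      assume "s \<le> j" then show "\<sigma> j \<in> I" using f \<sigma>(2)[of j] that by (auto simp: bij_betw_def)
    qed
    have "dense_graph m \<in> Pat pat"
    proof (rule Pat_permuted[OF wf_dense_graph, where q = p and \<sigma> = \<sigma>])
      show "bij_betw \<sigma> {..<length pat} {..<length pat}" using \<sigma> length_pat by simp
      show "\<And>v. v \<in> verts (dense_graph m) \<Longrightarrow> p v < length pat" using p(1) st length_pat by simp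
      fix j assume "j < length pat"
      then have j: "j < ?k" using length_pat by simp
      let ?S = "{v \<in> verts (dense_graph m). p v = j}"
      have wfJ: "wf_graph (induced (dense_graph m) ?S)" by (rule wf_induced[OF wf_dense_graph])
      have cJ: "card (verts (induced (dense_graph m) ?S)) \<le> ?N" using card_mono[of "{..<?N}" "verts (induced (dense_graph m) ?S)"] by auto
      show "induced (dense_graph m) ?S \<in> pat ! \<sigma> j"
      proof (cases "s \<le> j")
        case True
        then have "clique_set (dense_graph m) ?S" using p(3) j st by simp
        then have "clique (verts (induced (dense_graph m) ?S)) (edges (induced (dense_graph m) ?S))"
          by (auto simp: clique_set_def clique_def)
        moreover have "\<not> st (\<sigma> j)" "\<sigma> j < ?k" using \<sigma>I[OF j] True by (auto simp: I_def)
        ultimately show ?thesis using ramsey_dichotomy[of "\<sigma> j" ?N] wfJ cJ unfolding st_def by blast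
      next
        case False
        then have "stable_set (dense_graph m) ?S" using p(2) by simp
        then have "edges (induced (dense_graph m) ?S) = {}"
          by (intro induced_edgeless[OF wf_dense_graph]) (auto simp: stable_set_def)
        moreover have "st (\<sigma> j)" using \<sigma>I[OF j] False \<sigma>(1) j by (auto simp: I_def bij_betw_def)
        ultimately show ?thesis using wfJ cJ unfolding st_def by blast
      qed
    qed
    then show False using not_Pat by blast
  qed
  then have "st i" using i by (auto simp: I_def)
  then show ?thesis using J unfolding st_def by blast
qed

text \<open>The list \<open>cs\<close> colours the core with six colours so that all classes from colour \<open>r\<close> on are cliques
  of the sparse graph; the classes below \<open>r\<close> carry the graphs whose exclusion is to be shown. Outside the core each
  edge of the perfect matching is a class of its own.\<close>

lemma partition_witness:
  fixes cs :: "nat list"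
  assumes \<sigma>: "bij_betw \<sigma> {..<6+m} {..<6+m}"
    and chk: "list_all (\<lambda>u. cs ! u < 6 \<and> list_all (\<lambda>v. u \<noteq> v \<and> cs ! u = cs ! v \<and> r \<le> cs ! u \<longrightarrow> v \<in> set (core_nbrs ! u)) [0..<14]) [0..<14]"
    and r: "r \<le> 6" and J: "\<And>i. i < r \<Longrightarrow> induced (dense_graph m) {v. v < 14 \<and> cs ! v = i} \<in> pat ! (\<sigma> i)"
  shows False
proof -
  \<comment> \<open>The outer edges get the colours from \<open>14 div 2 - 1 = 6\<close> on,
    directly after the six colours of the core.\<close>
  define q where "q v = (if v < 14 then cs ! v else v div 2 - 1)" for v
  have cs: "cs ! u < 6" "v < 14 \<Longrightarrow> u \<noteq> v \<Longrightarrow> cs ! u = cs ! v \<Longrightarrow> r \<le> cs ! u \<Longrightarrow> sparse_adj u v" if "u < 14" for u v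
    using list_all_upt14D[OF chk that] that by (auto simp: list_all_iff sparse_adj_def)
  have "dense_graph m \<in> Pat pat"
  proof (rule Pat_permuted[OF wf_dense_graph, where q = q and \<sigma> = \<sigma>])
    show "bij_betw \<sigma> {..<length pat} {..<length pat}" using \<sigma> length_pat by simp
    show "q v < length pat" if "v \<in> verts (dense_graph m)" for v
      using that cs(1)[of v] by (auto simp: q_def length_pat)
    fix i assume "i < length pat"
    then have i: "i < 6 + m" "\<sigma> i < 6 + m" using length_pat \<sigma> by (auto simp: bij_betw_def)
    let ?S = "{v \<in> verts (dense_graph m). q v = i}"
    show "induced (dense_graph m) ?S \<in> pat ! \<sigma> i"
    proof (cases "i < r")
      case True
      have "?S = {v. v < 14 \<and> cs ! v = i}" using True r by (auto simp: q_def)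
      then show ?thesis using J[OF True] by simp
    next
      case False
      have "edges (induced (dense_graph m) ?S) = {}"
      proof (rule induced_edgeless[OF wf_dense_graph])
        fix u v assume uv: "u \<in> ?S" "v \<in> ?S" "u \<noteq> v"
        have "sparse_adj u v"
        proof (cases "u < 14")
          case True
          then have "v < 14" using cs(1)[OF True] uv by (auto simp: q_def split: if_splits)
          then show ?thesis using True cs(2)[of u v] uv False by (auto simp: q_def)
        next
          case u: False
          then have v: "\<not> v < 14" using cs(1)[of v] uv by (auto simp: q_def split: if_splits)
          then have "u div 2 - 1 = v div 2 - 1" "7 \<le> u div 2" "7 \<le> v div 2" using u uv by (auto simp: q_def)
          then show ?thesis using u v uv by (auto simp: sparse_adj_def)
        qed
        then show "{u,v} \<notin> edges (dense_graph m)" by (simp add: edges_dense_graph)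
      qed
      moreover have "card (verts (induced (dense_graph m) ?S)) \<le> 14 + 2 * m"
        using card_mono[of "{..<14+2*m}" "verts (induced (dense_graph m) ?S)"] by auto
      ultimately show ?thesis using edgeless_mem[OF i(2) wf_induced[OF wf_dense_graph]] by blast
    qed
  qed
  then show False using not_Pat by blast
qed

section \<open>Excluding small graphs from parts by splitting their complements off the core\<close>

text \<open>Matching two lists position by position turns an embedding into finitely many adjacency
  tests. Edges of \<open>G\<close> correspond to non-edges of the core because
  \<open>dense_graph m\<close> is the complement of \<open>C\<close>.\<close>

lemma induced_core_mem:
  assumes i: "i < 6 + m" and G: "G \<in> pat ! i" "set xs \<subseteq> verts G" "distinct xs"
    and W: "length ws = length xs" "distinct ws" "W = set ws" "W \<subseteq> {..<14}"
    and adj: "\<And>a b. a < b \<Longrightarrow> b < length ws \<Longrightarrow> {xs ! a, xs ! b} \<in> edges G \<longleftrightarrow> ws ! b \<notin> set (core_nbrs ! (ws ! a))"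
  shows "induced (dense_graph m) W \<in> pat ! i"
proof -
  define f where "f w = the (map_of (zip ws xs) w)" for w
  have f: "f (ws ! a) = xs ! a" if "a < length ws" for a
    using map_of_zip_nth[OF W(1,2)] that W(1) by (simp add: f_def)
  have wsW: "\<exists>a<length ws. w = ws ! a" if "w \<in> W" for w using that W(3) by (metis in_set_conv_nth)
  have vs: "verts (induced (dense_graph m) W) = W" using W(4) by auto
  have lt: "ws ! a < 14" if "a < length ws" for a using that W(3,4) nth_mem by blast
  have main: "{ws ! a, ws ! b} \<in> edges (dense_graph m) \<longleftrightarrow> {xs ! a, xs ! b} \<in> edges G"
    if "a < b" "b < length ws" for a b
  proof -
    have "ws ! a \<noteq> ws ! b" using that W(2) by (simp add: nth_eq_iff_index_eq)
    then show ?thesis using adj[OF that] lt[of a] lt[of b] that by (simp add: edges_dense_graph sparse_adj_def)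
  qed
  show ?thesis
  proof (rule hereditary_embed[OF hereditary_part[OF i] G(1) wf_induced[OF wf_dense_graph], of f])
    show "inj_on f (verts (induced (dense_graph m) W))" unfolding vs
    proof (rule inj_onI)
      fix u v assume "u \<in> W" "v \<in> W" "f u = f v"
      then show "u = v" using wsW f W(1) G(3) by (metis nth_eq_iff_index_eq)
    qed
    show "f ` verts (induced (dense_graph m) W) \<subseteq> verts G" unfolding vs
    proof
      fix x assume "x \<in> f ` W"
      then obtain a where "a < length ws" "x = xs ! a" using wsW f by blast
      then show "x \<in> verts G" using W(1) G(2) by auto
    qed
    fix u v assume *: "u \<in> verts (induced (dense_graph m) W)" "v \<in> verts (induced (dense_graph m) W)" "u \<noteq> v"
    then obtain a b where ab: "a < length ws" "b < length ws" "u = ws ! a" "v = ws ! b" using wsW unfolding vs by blast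
    then have "a \<noteq> b" using * by auto
    then have "{u,v} \<in> edges (dense_graph m) \<longleftrightarrow> {xs ! a, xs ! b} \<in> edges G"
      using main[of a b] main[of b a] ab by (cases "a < b") (auto simp: insert_commute)
    then show "({u, v} \<in> edges (induced (dense_graph m) W)) = ({f u, f v} \<in> edges G)"
      using * ab f unfolding vs by auto
  qed
qed

text \<open>Colour 0 goes to part \<open>i\<close>; the five other core colours and the
  \<open>m\<close> outer edges give cliques of \<open>C\<close>, that is, stable sets of
  \<open>H\<close>, and these fill the remaining \<open>5 + m\<close> parts.\<close>

lemma part_excludes:
  fixes cs :: "nat list"
  assumes i: "i < 6 + m" and G: "G \<in> pat ! i" "set xs \<subseteq> verts G" "distinct xs"
    and chk: "list_all (\<lambda>u. cs ! u < 6 \<and> list_all (\<lambda>v. u \<noteq> v \<and> cs ! u = cs ! v \<and> 1 \<le> cs ! u \<longrightarrow> v \<in> set (core_nbrs ! u)) [0..<14]) [0..<14]"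
    and ws: "list_all (\<lambda>u. cs ! u = 0 \<longleftrightarrow> u \<in> set ws) [0..<14]" "list_all (\<lambda>w. w < 14) ws" "length ws = length xs" "distinct ws"
    and adj: "\<And>a b. a < b \<Longrightarrow> b < length ws \<Longrightarrow> {xs ! a, xs ! b} \<in> edges G \<longleftrightarrow> ws ! b \<notin> set (core_nbrs ! (ws ! a))"
  shows False
proof -
  obtain \<sigma> where \<sigma>: "bij_betw \<sigma> {..<6+m} {..<6+m}" "\<And>a. a \<in> {0} \<Longrightarrow> \<sigma> a = i"
    by (rule bij_betw_extend[of "{..<6+m}" "{0}" "\<lambda>_. i"]) (use i in auto)
  have W: "{v. v < 14 \<and> cs ! v = 0} = set ws" using ws(1,2) by (auto simp: list_all_iff)
  have sub: "set ws \<subseteq> {..<14}" using ws(2) by (auto simp: list_all_iff)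
  have "induced (dense_graph m) (set ws) \<in> pat ! i"
    using induced_core_mem[OF i G ws(3,4) refl sub] adj by blast
  then show False by (intro partition_witness[OF \<sigma>(1) chk]) (use \<sigma>(2) W in auto)
qed

text \<open>Now two colours carry prescribed graphs and four remain for cliques of the core. In the
  applications the core splits as \<open>3 + 3 + 4 * 2 = 14\<close>.\<close>

lemma two_parts_exclude:
  fixes cs :: "nat list"
  assumes i: "i < 6 + m" and G: "G \<in> pat ! i" "set xs \<subseteq> verts G" "distinct xs"
    and i': "i' < 6 + m" and G': "G' \<in> pat ! i'" "set xs' \<subseteq> verts G'" "distinct xs'"
    and ne: "i \<noteq> i'"
    and chk: "list_all (\<lambda>u. cs ! u < 6 \<and> list_all (\<lambda>v. u \<noteq> v \<and> cs ! u = cs ! v \<and> 2 \<le> cs ! u \<longrightarrow> v \<in> set (core_nbrs ! u)) [0..<14]) [0..<14]"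
    and ws: "list_all (\<lambda>u. cs ! u = 0 \<longleftrightarrow> u \<in> set ws) [0..<14]" "list_all (\<lambda>w. w < 14) ws" "length ws = length xs" "distinct ws"
    and adj: "\<And>a b. a < b \<Longrightarrow> b < length ws \<Longrightarrow> {xs ! a, xs ! b} \<in> edges G \<longleftrightarrow> ws ! b \<notin> set (core_nbrs ! (ws ! a))"
    and ws': "list_all (\<lambda>u. cs ! u = 1 \<longleftrightarrow> u \<in> set ws') [0..<14]" "list_all (\<lambda>w. w < 14) ws'" "length ws' = length xs'" "distinct ws'"
    and adj': "\<And>a b. a < b \<Longrightarrow> b < length ws' \<Longrightarrow> {xs' ! a, xs' ! b} \<in> edges G' \<longleftrightarrow> ws' ! b \<notin> set (core_nbrs ! (ws' ! a))"
  shows False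
proof -
  obtain \<sigma> where \<sigma>: "bij_betw \<sigma> {..<6+m} {..<6+m}" "\<And>a. a \<in> {0,1} \<Longrightarrow> \<sigma> a = (if a = 0 then i else i')"
    by (rule bij_betw_extend[of "{..<6+m}" "{0,1}" "\<lambda>a. if a = 0 then i else i'"])
       (use i i' ne in \<open>auto simp: inj_on_def split: if_splits\<close>)
  have W: "{v. v < 14 \<and> cs ! v = 0} = set ws" using ws(1,2) by (auto simp: list_all_iff)
  have W': "{v. v < 14 \<and> cs ! v = 1} = set ws'" using ws'(1,2) by (auto simp: list_all_iff)
  have sub: "set ws \<subseteq> {..<14}" "set ws' \<subseteq> {..<14}" using ws(2) ws'(2) by (auto simp: list_all_iff)
  have "induced (dense_graph m) (set ws) \<in> pat ! i"
    using induced_core_mem[OF i G ws(3,4) refl sub(1)] adj by blast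
  moreover have "induced (dense_graph m) (set ws') \<in> pat ! i'"
    using induced_core_mem[OF i' G' ws'(3,4) refl sub(2)] adj' by blast
  ultimately show False
    by (intro partition_witness[OF \<sigma>(1) chk]) (use \<sigma>(2) W W' in \<open>auto simp: less_2_cases_iff\<close>)
qed

end

section \<open>Structure of a single part with at least four vertices\<close>

context clean_dense_pattern
begin

context
  fixes i :: nat and G :: graph
  assumes i: "i < 6 + m" and G: "G \<in> pat ! i"
begin

lemma wf_part: "wf_graph G"
  using hereditary_part[OF i] G by (auto simp: hereditary_def)

lemma part_excludes4:
  fixes cs :: "nat list"
  assumes "{a,b,c,d} \<subseteq> verts G" "distinct [a,b,c,d]"
    and "list_all (\<lambda>u. cs ! u < 6 \<and> list_all (\<lambda>v. u \<noteq> v \<and> cs ! u = cs ! v \<and> 1 \<le> cs ! u \<longrightarrow> v \<in> set (core_nbrs ! u)) [0..<14]) [0..<14]"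
    and "list_all (\<lambda>u. cs ! u = 0 \<longleftrightarrow> u \<in> set [w0,w1,w2,w3]) [0..<14]"
    and "list_all (\<lambda>w. w < 14) [w0,w1,w2,w3]" "distinct [w0,w1,w2,w3]"
    and "{a,b} \<in> edges G \<longleftrightarrow> w1 \<notin> set (core_nbrs ! w0)" "{a,c} \<in> edges G \<longleftrightarrow> w2 \<notin> set (core_nbrs ! w0)"
      "{a,d} \<in> edges G \<longleftrightarrow> w3 \<notin> set (core_nbrs ! w0)" "{b,c} \<in> edges G \<longleftrightarrow> w2 \<notin> set (core_nbrs ! w1)"
      "{b,d} \<in> edges G \<longleftrightarrow> w3 \<notin> set (core_nbrs ! w1)" "{c,d} \<in> edges G \<longleftrightarrow> w3 \<notin> set (core_nbrs ! w2)"
  shows False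
proof (rule part_excludes[OF i G _ assms(2,3,4,5) _ assms(6)])
  fix x y :: nat assume *: "x < y" "y < length [w0,w1,w2,w3]"
  then have "y = 1 \<or> y = 2 \<or> y = 3" "x < y" by auto
  then have "x = 0 \<and> y = 1 \<or> x = 0 \<and> y = 2 \<or> x = 0 \<and> y = 3 \<or> x = 1 \<and> y = 2 \<or> x = 1 \<and> y = 3 \<or> x = 2 \<and> y = 3"
    by linarith
  then show "{[a,b,c,d] ! x, [a,b,c,d] ! y} \<in> edges G \<longleftrightarrow> [w0,w1,w2,w3] ! y \<notin> set (core_nbrs ! ([w0,w1,w2,w3] ! x))"
    using assms(7-) by (elim disjE conjE) simp_all
qed (use assms(1) in auto)

text \<open>In this and the next seven lemmas, colour 0 marks the complement of the excluded graph,
  here the 4-cycle, and colours 1 to 5 form a perfect matching of the other ten core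
  vertices.\<close>

lemma part_no_2K2:
  assumes "{a,b,c,d} \<subseteq> verts G" "distinct [a,b,c,d]"
    "{a,b} \<in> edges G" "{c,d} \<in> edges G" "{a,c} \<notin> edges G" "{a,d} \<notin> edges G" "{b,c} \<notin> edges G" "{b,d} \<notin> edges G"
  shows False
  by (rule part_excludes4[OF assms(1,2), of "[1,2,2,1,0,0,0,0,3,3,4,5,4,5]" 4 6 5 7])
     (use assms(3-) in \<open>simp_all add: core_nbrs_def upt_rec\<close>)

lemma part_no_P3_K1:
  assumes "{a,b,c,d} \<subseteq> verts G" "distinct [a,b,c,d]"
    "{a,b} \<in> edges G" "{a,c} \<in> edges G" "{b,c} \<notin> edges G" "{a,d} \<notin> edges G" "{b,d} \<notin> edges G" "{c,d} \<notin> edges G"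
  shows False
  by (rule part_excludes4[OF assms(1,2), of "[0,0,0,0,1,1,2,2,3,3,4,5,4,5]" 3 1 2 0])
     (use assms(3-) in \<open>simp_all add: core_nbrs_def upt_rec\<close>)

lemma part_no_K3_K1:
  assumes "{a,b,c,d} \<subseteq> verts G" "distinct [a,b,c,d]"
    "{a,b} \<in> edges G" "{a,c} \<in> edges G" "{b,c} \<in> edges G" "{a,d} \<notin> edges G" "{b,d} \<notin> edges G" "{c,d} \<notin> edges G"
  shows False
  by (rule part_excludes4[OF assms(1,2), of "[1,2,2,1,3,3,4,4,0,0,0,0,5,5]" 9 10 11 8])
     (use assms(3-) in \<open>simp_all add: core_nbrs_def upt_rec\<close>)

lemma part_no_P4:
  assumes "{a,b,c,d} \<subseteq> verts G" "distinct [a,b,c,d]"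
    "{a,b} \<in> edges G" "{b,c} \<in> edges G" "{c,d} \<in> edges G" "{a,c} \<notin> edges G" "{a,d} \<notin> edges G" "{b,d} \<notin> edges G"
  shows False
  by (rule part_excludes4[OF assms(1,2), of "[1,2,2,1,3,3,4,4,0,0,0,5,0,5]" 10 9 12 8])
     (use assms(3-) in \<open>simp_all add: core_nbrs_def upt_rec\<close>)

lemma part_no_C4:
  assumes "{a,b,c,d} \<subseteq> verts G" "distinct [a,b,c,d]"
    "{a,b} \<in> edges G" "{b,c} \<in> edges G" "{c,d} \<in> edges G" "{a,c} \<notin> edges G" "{a,d} \<in> edges G" "{b,d} \<notin> edges G"
  shows False
  by (rule part_excludes4[OF assms(1,2), of "[0,1,1,0,0,0,2,2,3,3,4,5,4,5]" 0 4 3 5])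
     (use assms(3-) in \<open>simp_all add: core_nbrs_def upt_rec\<close>)

lemma part_no_paw:
  assumes "{a,b,c,d} \<subseteq> verts G" "distinct [a,b,c,d]"
    "{a,b} \<in> edges G" "{a,c} \<in> edges G" "{b,c} \<in> edges G" "{a,d} \<in> edges G" "{b,d} \<notin> edges G" "{c,d} \<notin> edges G"
  shows False
  by (rule part_excludes4[OF assms(1,2), of "[1,2,2,1,3,3,4,4,5,0,5,0,0,0]" 9 11 12 13])
     (use assms(3-) in \<open>simp_all add: core_nbrs_def upt_rec\<close>)

lemma part_no_diamond:
  assumes "{a,b,c,d} \<subseteq> verts G" "distinct [a,b,c,d]"
    "{a,b} \<in> edges G" "{a,c} \<in> edges G" "{b,c} \<in> edges G" "{a,d} \<in> edges G" "{b,d} \<in> edges G" "{c,d} \<notin> edges G"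
  shows False
  by (rule part_excludes4[OF assms(1,2), of "[0,1,1,0,2,2,3,3,4,0,0,4,5,5]" 9 10 0 3])
     (use assms(3-) in \<open>simp_all add: core_nbrs_def upt_rec\<close>)

lemma part_no_K4:
  assumes "{a,b,c,d} \<subseteq> verts G" "distinct [a,b,c,d]"
    "{a,b} \<in> edges G" "{a,c} \<in> edges G" "{b,c} \<in> edges G" "{a,d} \<in> edges G" "{b,d} \<in> edges G" "{c,d} \<in> edges G"
  shows False
  by (rule part_excludes4[OF assms(1,2), of "[1,1,0,0,2,2,3,3,4,0,0,4,5,5]" 9 10 3 2])
     (use assms(3-) in \<open>simp_all add: core_nbrs_def upt_rec\<close>)

text \<open>Of the three four-vertex graphs that are not excluded, only the claw has two edges with
  a common end.\<close>

lemma cherry_forces_claw: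
  assumes V: "{w,x,y,z} \<subseteq> verts G" and dist: "distinct [w,x,y,z]"
    and E: "{w,x} \<in> edges G" "{w,y} \<in> edges G"
  shows "{w,z} \<in> edges G \<and> {x,y} \<notin> edges G \<and> {x,z} \<notin> edges G \<and> {y,z} \<notin> edges G"
proof (rule ccontr)
  define A where "A u v \<longleftrightarrow> {u,v} \<in> edges G" for u v
  have sym: "A u v \<longleftrightarrow> A v u" for u v by (simp add: A_def insert_commute)
  \<comment> \<open>The four undecided pairs admit 16 edge patterns. Each of the 15 other than the
    claw is refuted by one of the 15 instances listed.\<close>
  note rules = part_no_P3_K1[of w x y z] part_no_K3_K1[of w x y z] part_no_P4[of z x w y] part_no_P4[of z y w x]
    part_no_paw[of w x y z] part_no_paw[of x w y z] part_no_paw[of y w x z] part_no_paw[of w x z y] part_no_paw[of w y z x]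
    part_no_C4[of w x z y] part_no_diamond[of w z x y] part_no_diamond[of x y w z] part_no_diamond[of w y x z]
    part_no_diamond[of w x y z] part_no_K4[of w x y z]
  have V': "w \<in> verts G" "x \<in> verts G" "y \<in> verts G" "z \<in> verts G" using V by auto
  have ne: "w \<noteq> x" "w \<noteq> y" "w \<noteq> z" "x \<noteq> y" "x \<noteq> z" "y \<noteq> z" "x \<noteq> w" "y \<noteq> w" "z \<noteq> w" "y \<noteq> x" "z \<noteq> x" "z \<noteq> y"
    using dist by auto
  assume "\<not> ?thesis"
  then show False using rules E V' ne sym[of w x] sym[of w y] sym[of w z] sym[of x y] sym[of x z] sym[of y z]
    unfolding A_def[symmetric] by (simp add: V' ne) argo
qed

text \<open>If a vertex has two neighbours, comparison with each further vertex makes it the centre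
  of a spanning star. Otherwise any two edges would be disjoint with nothing between them, an
  excluded 2K2.\<close>

lemma part_structure:
  assumes four: "4 \<le> card (verts G)"
  shows "edges G = {} \<or> (\<exists>e. edges G = {e}) \<or> (\<exists>w\<in>verts G. edges G = {{w,z} |z. z \<in> verts G - {w}})"
proof -
  have wf: "wf_graph G" by (rule wf_part)
  have eV: "a \<in> verts G \<and> b \<in> verts G \<and> a \<noteq> b" if "{a,b} \<in> edges G" for a b
    using wf that wf_graph_loop[OF wf, of a] unfolding wf_graph_def by (auto)
  have pair: "\<exists>a b. e = {a,b}" if "e \<in> edges G" for e
    using wf that unfolding wf_graph_def by (metis card_2_iff)
  have fourth: "\<exists>z\<in>verts G. z \<noteq> a \<and> z \<noteq> b \<and> z \<noteq> c" for a b c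
  proof (rule ccontr)
    assume "\<not> ?thesis"
    then have "verts G \<subseteq> {a,b,c}" by auto
    then have "card (verts G) \<le> card {a,b,c}" by (intro card_mono) auto
    also have "\<dots> \<le> 3" by (simp add: card_insert_if)
    finally show False using four by simp
  qed
  show ?thesis
  proof (cases "\<exists>w x y. {w,x} \<in> edges G \<and> {w,y} \<in> edges G \<and> x \<noteq> y")
    case True
    then obtain w x y where wxy: "{w,x} \<in> edges G" "{w,y} \<in> edges G" "x \<noteq> y" by blast
    have wV: "w \<in> verts G" using eV wxy by blast
    have full: "{w,z} \<in> edges G" if "z \<in> verts G" "z \<noteq> w" for z
    proof (cases "z = x \<or> z = y")
      case False
      then show ?thesis using cherry_forces_claw[of w x y z] wxy that eV[OF wxy(1)] eV[OF wxy(2)] by auto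
    qed (use wxy in auto)
    have none: "{u,v} \<notin> edges G" if "u \<noteq> w" "v \<noteq> w" for u v
    proof
      assume uv: "{u,v} \<in> edges G"
      obtain z where "z \<in> verts G" "z \<noteq> w" "z \<noteq> u" "z \<noteq> v" using fourth by blast
      then show False using cherry_forces_claw[of w u v z] full[of u] full[of v] eV[OF uv] wV that uv by auto
    qed
    have "edges G = {{w,z} |z. z \<in> verts G - {w}}"
    proof (intro equalityI subsetI)
      fix e assume e: "e \<in> edges G"
      then obtain a b where ab: "e = {a,b}" using pair by blast
      then have "a = w \<or> b = w" using none e by blast
      then show "e \<in> {{w,z} |z. z \<in> verts G - {w}}" using ab eV[of a b] e by (auto simp: insert_commute)
    qed (use full in auto)
    then show ?thesis using wV by blast
  next
    case False
    have uniq: "e = e'" if e: "e \<in> edges G" "e' \<in> edges G" for e e'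
    proof (rule ccontr)
      assume ne: "e \<noteq> e'"
      obtain a b c d where abcd: "e = {a,b}" "e' = {c,d}" using pair e by metis
      have *: "{w,x} \<in> edges G \<Longrightarrow> {w,y} \<in> edges G \<Longrightarrow> x = y" "{w,x} \<in> edges G \<Longrightarrow> {y,w} \<in> edges G \<Longrightarrow> x = y" for w x y
        using False by (auto simp: insert_commute)
      have E: "{a,b} \<in> edges G" "{b,a} \<in> edges G" "{c,d} \<in> edges G" "{d,c} \<in> edges G"
        using e abcd by (auto simp: insert_commute)
      have d: "a \<noteq> c" "a \<noteq> d" "b \<noteq> c" "b \<noteq> d" using *(1) E ne abcd by (metis insert_commute)+
      have n: "{a,c} \<notin> edges G" "{a,d} \<notin> edges G" "{b,c} \<notin> edges G" "{b,d} \<notin> edges G"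
        using *(1)[OF E(1), of c] *(1)[OF E(1), of d] *(1)[OF E(2), of c] *(1)[OF E(2), of d] d by blast+
      show False
      proof (rule part_no_2K2[OF _ _ E(1,3) n])
        show "{a,b,c,d} \<subseteq> verts G" "distinct [a,b,c,d]" using eV[OF E(1)] eV[OF E(3)] d by simp_all
      qed
    qed
    show ?thesis
    proof (cases "edges G = {}")
      case nonempty: False
      then obtain e where "e \<in> edges G" by blast
      then have "edges G = {e}" using uniq by blast
      then show ?thesis by blast
    qed simp
  qed
qed

text \<open>Cuts a part with an edge down to three vertices, so that two such parts can be split off
  the core simultaneously.\<close>

lemma part_with_edge:
  assumes four: "4 \<le> card (verts G)" and "edges G \<noteq> {}"
  obtains a b c where "{a,b,c} \<subseteq> verts G" "distinct [a,b,c]" "{a,b} \<in> edges G" "{a,c} \<notin> edges G" "{b,c} \<notin> edges G"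
  | a b c where "{a,b,c} \<subseteq> verts G" "distinct [a,b,c]" "{a,b} \<notin> edges G" "{a,c} \<in> edges G" "{b,c} \<in> edges G"
proof -
  have fin: "finite (verts G)" using wf_part by (simp add: wf_graph_def)
  have third: "\<exists>z\<in>verts G. z \<notin> X" if "card X \<le> 3" "finite X" for X
    using card_mono[of X "verts G"] four that by force
  from part_structure[OF four] assms(2) consider e where "edges G = {e}"
    | w where "w \<in> verts G" "edges G = {{w,z} |z. z \<in> verts G - {w}}" by blast
  then show thesis
  proof cases
    case 1
    then obtain a b where ab: "e = {a,b}" "a \<noteq> b" "a \<in> verts G" "b \<in> verts G"
      using wf_part by (auto simp: wf_graph_def card_2_iff)
    obtain c where c: "c \<in> verts G" "c \<notin> {a,b}" using third[of "{a,b}"] ab by auto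
    show thesis by (rule that(1)[of a b c]) (use 1 ab c in \<open>auto simp: doubleton_eq_iff\<close>)
  next
    case 2
    obtain a where a: "a \<in> verts G" "a \<notin> {w}" using third[of "{w}"] by auto
    obtain b where b: "b \<in> verts G" "b \<notin> {w,a}" using third[of "{w,a}"] a by auto
    show thesis by (rule that(2)[of a b w]) (use 2 a b in \<open>auto simp: doubleton_eq_iff\<close>)
  qed
qed

end

section \<open>Edges in two parts at once\<close>

lemma two_parts_exclude3:
  fixes cs :: "nat list"
  assumes i: "i < 6 + m" and G: "G \<in> pat ! i" "{a,b,c} \<subseteq> verts G" "distinct [a,b,c]"
    and i': "i' < 6 + m" and G': "G' \<in> pat ! i'" "{a',b',c'} \<subseteq> verts G'" "distinct [a',b',c']"
    and ne: "i \<noteq> i'"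
    and chk: "list_all (\<lambda>u. cs ! u < 6 \<and> list_all (\<lambda>v. u \<noteq> v \<and> cs ! u = cs ! v \<and> 2 \<le> cs ! u \<longrightarrow> v \<in> set (core_nbrs ! u)) [0..<14]) [0..<14]"
    and ws: "list_all (\<lambda>u. cs ! u = 0 \<longleftrightarrow> u \<in> set [w0,w1,w2]) [0..<14]" "list_all (\<lambda>w. w < 14) [w0,w1,w2]" "distinct [w0,w1,w2]"
    and adj: "{a,b} \<in> edges G \<longleftrightarrow> w1 \<notin> set (core_nbrs ! w0)" "{a,c} \<in> edges G \<longleftrightarrow> w2 \<notin> set (core_nbrs ! w0)"
       "{b,c} \<in> edges G \<longleftrightarrow> w2 \<notin> set (core_nbrs ! w1)"
    and ws': "list_all (\<lambda>u. cs ! u = 1 \<longleftrightarrow> u \<in> set [w0',w1',w2']) [0..<14]" "list_all (\<lambda>w. w < 14) [w0',w1',w2']" "distinct [w0',w1',w2']"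
    and adj': "{a',b'} \<in> edges G' \<longleftrightarrow> w1' \<notin> set (core_nbrs ! w0')" "{a',c'} \<in> edges G' \<longleftrightarrow> w2' \<notin> set (core_nbrs ! w0')"
       "{b',c'} \<in> edges G' \<longleftrightarrow> w2' \<notin> set (core_nbrs ! w1')"
  shows False
proof (rule two_parts_exclude[OF i G(1) _ G(3) i' G'(1) _ G'(3) ne chk ws(1,2) _ ws(3) _ ws'(1,2) _ ws'(3)])
  have less3: "x = 0 \<and> y = 1 \<or> x = 0 \<and> y = 2 \<or> x = 1 \<and> y = 2" if "x < y" "y < 3" for x y :: nat
    using that by linarith
  show "{[a,b,c] ! x, [a,b,c] ! y} \<in> edges G \<longleftrightarrow> [w0,w1,w2] ! y \<notin> set (core_nbrs ! ([w0,w1,w2] ! x))"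
    if "x < y" "y < length [w0,w1,w2]" for x y
  proof -
    have "x = 0 \<and> y = 1 \<or> x = 0 \<and> y = 2 \<or> x = 1 \<and> y = 2" using less3[of x y] that by simp
    then show ?thesis using adj by (elim disjE conjE) simp_all
  qed
  show "{[a',b',c'] ! x, [a',b',c'] ! y} \<in> edges G' \<longleftrightarrow> [w0',w1',w2'] ! y \<notin> set (core_nbrs ! ([w0',w1',w2'] ! x))"
    if "x < y" "y < length [w0',w1',w2']" for x y
  proof -
    have "x = 0 \<and> y = 1 \<or> x = 0 \<and> y = 2 \<or> x = 1 \<and> y = 2" using less3[of x y] that by simp
    then show ?thesis using adj' by (elim disjE conjE) simp_all
  qed
qed (use G(2) G'(2) in auto)

text \<open>For each combination of an edge plus isolated vertex or a path in either part, the two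
  complements fit into the core disjointly and the remaining eight vertices have a perfect
  matching.\<close>

lemma two_parts_with_edges:
  assumes i: "i < 6 + m" "G \<in> pat ! i" "4 \<le> card (verts G)" "edges G \<noteq> {}"
    and i': "i' < 6 + m" "G' \<in> pat ! i'" "4 \<le> card (verts G')" "edges G' \<noteq> {}" and ne: "i \<noteq> i'"
  shows False
proof -
  have mixed: False
    if "j < 6 + m" "K \<in> pat ! j" "{a,b,c} \<subseteq> verts K" "distinct [a,b,c]" "{a,b} \<in> edges K" "{a,c} \<notin> edges K" "{b,c} \<notin> edges K"
      "j' < 6 + m" "K' \<in> pat ! j'" "{a',b',c'} \<subseteq> verts K'" "distinct [a',b',c']" "{a',b'} \<notin> edges K'" "{a',c'} \<in> edges K'" "{b',c'} \<in> edges K'"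
      "j \<noteq> j'" for j K a b c j' K' a' b' c'
    by (rule two_parts_exclude3[OF that(1-4,8-11,15), of "[2,3,3,2,4,4,5,5,0,1,0,1,0,1]" 8 12 10 11 13 9])
       (use that in \<open>simp_all add: core_nbrs_def upt_rec\<close>)
  show False
  proof (rule part_with_edge[OF i])
    fix a b c assume 1: "{a,b,c} \<subseteq> verts G" "distinct [a,b,c]" "{a,b} \<in> edges G" "{a,c} \<notin> edges G" "{b,c} \<notin> edges G"
    show False
    proof (rule part_with_edge[OF i'])
      fix a' b' c' assume 2: "{a',b',c'} \<subseteq> verts G'" "distinct [a',b',c']" "{a',b'} \<in> edges G'" "{a',c'} \<notin> edges G'" "{b',c'} \<notin> edges G'"
      show False
        by (rule two_parts_exclude3[OF i(1,2) 1(1,2) i'(1,2) 2(1,2) ne, of "[2,3,3,2,4,4,5,5,0,0,0,1,1,1]" 9 10 8 12 11 13])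
           (use 1 2 in \<open>simp_all add: core_nbrs_def upt_rec\<close>)
    qed (use mixed[OF i(1,2) 1 i'(1,2) _ _ _ _ _ ne] in blast)
  next
    fix a b c assume 1: "{a,b,c} \<subseteq> verts G" "distinct [a,b,c]" "{a,b} \<notin> edges G" "{a,c} \<in> edges G" "{b,c} \<in> edges G"
    show False
    proof (rule part_with_edge[OF i'])
      fix a' b' c' assume 2: "{a',b',c'} \<subseteq> verts G'" "distinct [a',b',c']" "{a',b'} \<in> edges G'" "{a',c'} \<notin> edges G'" "{b',c'} \<notin> edges G'"
      show False using mixed[OF i'(1,2) 2 i(1,2) 1] ne by blast
    next
      fix a' b' c' assume 2: "{a',b',c'} \<subseteq> verts G'" "distinct [a',b',c']" "{a',b'} \<notin> edges G'" "{a',c'} \<in> edges G'" "{b',c'} \<in> edges G'"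
      show False
        by (rule two_parts_exclude3[OF i(1,2) 1(1,2) i'(1,2) 2(1,2) ne, of "[0,2,2,0,1,1,3,3,4,0,1,4,5,5]" 0 3 9 4 5 10])
           (use 1 2 in \<open>simp_all add: core_nbrs_def upt_rec\<close>)
    qed
  qed
qed

end

subsection \<open>Weights of colourings\<close>

definition colourings :: "nat \<Rightarrow> nat \<Rightarrow> (nat \<Rightarrow> nat) set" where
  "colourings n k = {1..n} \<rightarrow>\<^sub>E {..<k}"

definition colour_class :: "nat \<Rightarrow> (nat \<Rightarrow> nat) \<Rightarrow> nat \<Rightarrow> nat set" where
  "colour_class n p i = {v \<in> {1..n}. p v = i}"

definition inner_pairs :: "nat \<Rightarrow> (nat \<Rightarrow> nat) \<Rightarrow> nat set set" where
  "inner_pairs n p = {e \<in> nsets {1..n} 2. \<exists>i. \<forall>v\<in>e. p v = i}"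

definition cross_pairs :: "nat \<Rightarrow> (nat \<Rightarrow> nat) \<Rightarrow> nat set set" where
  "cross_pairs n p = nsets {1..n} 2 - inner_pairs n p"

definition balanced :: "nat \<Rightarrow> nat \<Rightarrow> (nat \<Rightarrow> nat) set" where
  "balanced n k = {p \<in> colourings n k. \<forall>i<k. n \<le> 2 * k * card (colour_class n p i)}"

lemma finite_colourings [simp]: "finite (colourings n k)"
  by (simp add: colourings_def finite_PiE)

lemma card_colourings: "card (colourings n k) = k ^ n"
  by (simp add: colourings_def card_funcsetE)

lemma finite_balanced [simp]: "finite (balanced n k)"
  by (simp add: balanced_def)

lemma balanced_subset: "balanced n k \<subseteq> colourings n k"
  by (auto simp: balanced_def)

lemma colourings_less: "p \<in> colourings n k \<Longrightarrow> v \<in> {1..n} \<Longrightarrow> p v < k"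
  by (auto simp: colourings_def)

lemma finite_colour_class [simp]: "finite (colour_class n p i)"
  by (simp add: colour_class_def)

lemma finite_inner_pairs [simp]: "finite (inner_pairs n p)"
  by (simp add: inner_pairs_def finite_imp_finite_nsets)

lemma finite_cross_pairs [simp]: "finite (cross_pairs n p)"
  by (simp add: cross_pairs_def finite_imp_finite_nsets)

lemma doubleton_inner_pairs: "{u,v} \<in> inner_pairs n p \<longleftrightarrow> u \<in> {1..n} \<and> v \<in> {1..n} \<and> u \<noteq> v \<and> p u = p v"
  by (auto simp: inner_pairs_def)

lemma doubleton_cross_pairs: "{u,v} \<in> cross_pairs n p \<longleftrightarrow> u \<in> {1..n} \<and> v \<in> {1..n} \<and> p u \<noteq> p v"
  by (auto simp: cross_pairs_def doubleton_inner_pairs)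

lemma cross_Un_inner_pairs: "nsets {1..n} 2 = cross_pairs n p \<union> inner_pairs n p" "cross_pairs n p \<inter> inner_pairs n p = {}"
  by (auto simp: cross_pairs_def inner_pairs_def)

lemma sum_card_colour_class:
  assumes "p \<in> colourings n k" shows "(\<Sum>i<k. card (colour_class n p i)) = n"
proof -
  have "{1..n} = (\<Union>i<k. colour_class n p i)" using assms by (auto simp: colour_class_def colourings_less)
  then have "n = card (\<Union>i<k. colour_class n p i)" by (metis card_atLeastAtMost diff_Suc_1)
  also have "\<dots> = (\<Sum>i<k. card (colour_class n p i))"
    by (rule card_UN_disjoint) (auto simp: colour_class_def)
  finally show ?thesis ..
qed

lemma two_choose_two: "2 * (x choose 2) + x = x\<^sup>2"
  by (cases x) (auto simp: choose_two power2_eq_square)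

text \<open>Counts ordered pairs, the diagonal included: each class of size \<open>c\<close>
  contributes \<open>c^2\<close> monochromatic ones.\<close>

lemma card_cross_pairs:
  assumes p: "p \<in> colourings n k"
  shows "2 * card (cross_pairs n p) + (\<Sum>i<k. (card (colour_class n p i))\<^sup>2) = n\<^sup>2"
proof -
  have "inner_pairs n p = (\<Union>i<k. nsets (colour_class n p i) 2)"
  proof (intro equalityI subsetI)
    fix e assume "e \<in> inner_pairs n p"
    then obtain i where e: "e \<in> nsets {1..n} 2" "\<forall>v\<in>e. p v = i" by (auto simp: inner_pairs_def)
    then obtain v where "v \<in> e" "v \<in> {1..n}" by (fastforce simp: nsets_def card_2_iff)
    then have "i < k" using e colourings_less[OF p, of v] by auto
    then show "e \<in> (\<Union>i<k. nsets (colour_class n p i) 2)"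
      using e by (intro UN_I[of i]) (auto simp: nsets_def colour_class_def)
  qed (auto simp: inner_pairs_def nsets_def colour_class_def)
  also have "card \<dots> = (\<Sum>i<k. card (nsets (colour_class n p i) 2))"
  proof (rule card_UN_disjoint; (intro ballI impI)?)
    fix i j :: nat assume "i \<noteq> j"
    have False if e: "e \<in> nsets (colour_class n p i) 2" "e \<in> nsets (colour_class n p j) 2" for e
    proof -
      obtain v where "v \<in> e" using e by (fastforce simp: nsets_def card_2_iff)
      then show False using e \<open>i \<noteq> j\<close> by (auto simp: nsets_def colour_class_def)
    qed
    then show "nsets (colour_class n p i) 2 \<inter> nsets (colour_class n p j) 2 = {}" by blast
  qed (auto simp: finite_imp_finite_nsets)
  finally have "2 * card (inner_pairs n p) + n = (\<Sum>i<k. 2 * (card (colour_class n p i) choose 2) + card (colour_class n p i))"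
    by (simp add: sum.distrib sum_card_colour_class[OF p] sum_distrib_left)
  then have "2 * card (inner_pairs n p) + n = (\<Sum>i<k. (card (colour_class n p i))\<^sup>2)"
    by (simp add: two_choose_two)
  moreover have "card (cross_pairs n p) + card (inner_pairs n p) = n choose 2"
    using card_Un_disjoint[OF finite_cross_pairs finite_inner_pairs cross_Un_inner_pairs(2), of n p]
    by (simp flip: cross_Un_inner_pairs(1))
  ultimately show ?thesis using two_choose_two[of n] by linarith
qed

text \<open>The sum of squared deviations from the mean \<open>n / k\<close> is at least any single
  one of them.\<close>

lemma sum_squares_lower:
  fixes c :: "nat \<Rightarrow> real"
  assumes k: "k > 0" and s: "(\<Sum>i<k. c i) = n" and j: "j < k"
  shows "n\<^sup>2 / k + (c j - n / k)\<^sup>2 \<le> (\<Sum>i<k. (c i)\<^sup>2)"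
proof -
  have "(c j - n / k)\<^sup>2 \<le> (\<Sum>i<k. (c i - n / k)\<^sup>2)"
    using j by (intro member_le_sum) auto
  also have "\<dots> = (\<Sum>i<k. (c i)\<^sup>2) - 2 * (n / k) * (\<Sum>i<k. c i) + k * (n / k)\<^sup>2"
    by (simp add: power2_diff sum.distrib sum_subtractf sum_distrib_left sum_divide_distrib algebra_simps)
  also have "\<dots> = (\<Sum>i<k. (c i)\<^sup>2) - n\<^sup>2 / k"
    using k by (simp add: s field_simps power2_eq_square)
  finally show ?thesis by simp
qed

lemma card_cross_unbalanced:
  assumes k: "k > 0" and p: "p \<in> colourings n k" "p \<notin> balanced n k"
  shows "2 * real (card (cross_pairs n p)) \<le> real n ^ 2 - real n ^ 2 / k - (n / (2 * real k))\<^sup>2"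
proof -
  obtain j where j: "j < k" "2 * k * card (colour_class n p j) < n"
    using p by (auto simp: balanced_def not_le)
  define c where "c i = real (card (colour_class n p i))" for i
  have "2 * k * c j \<le> n" using j(2) unfolding c_def by (metis of_nat_mult of_nat_numeral of_nat_mono less_imp_le)
  then have "c j \<le> n / (2 * k)" using k by (simp add: field_simps)
  then have "n / (2 * k) \<le> n / k - c j" by (simp add: field_simps)
  then have "(n / (2 * k))\<^sup>2 \<le> (n / k - c j)\<^sup>2" by (intro power_mono) auto
  also have "\<dots> = (c j - n / k)\<^sup>2" by (simp add: power2_commute)
  finally have 1: "(n / (2 * k))\<^sup>2 \<le> (c j - n / k)\<^sup>2" .
  have "(\<Sum>i<k. c i) = n" unfolding c_def using sum_card_colour_class[OF p(1)] by (metis of_nat_sum)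
  from sum_squares_lower[OF k this j(1)] have "(\<Sum>i<k. (c i)\<^sup>2) \<ge> real n ^ 2 / k + (n / (2 * real k))\<^sup>2" using 1 by simp
  moreover have "2 * real (card (cross_pairs n p)) + (\<Sum>i<k. (c i)\<^sup>2) = real n ^ 2"
    using arg_cong[OF card_cross_pairs[OF p(1)], of real] by (simp add: c_def)
  ultimately show ?thesis by linarith
qed

lemma ex_card_cross_large:
  assumes k: "k > 0"
  obtains p where "p \<in> colourings n k" "real n ^ 2 - real n ^ 2 / k - n \<le> 2 * real (card (cross_pairs n p))"
proof -
  \<comment> \<open>The classes will be intervals of length at most \<open>L\<close>. Adding 1 makes
    \<open>n < k * L\<close>, so even the vertex \<open>n\<close> gets a colour below
    \<open>k\<close>.\<close>
  define L where "L = n div k + 1"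
  define p where "p = restrict (\<lambda>v. v div L) {1..n}"
  have nL: "n < k * L" using dividend_less_times_div[OF k, of n] by (simp add: L_def algebra_simps)
  have p: "p \<in> colourings n k"
  proof -
    have "v div L < k" if "v \<le> n" for v
      by (rule less_mult_imp_div_less) (use nL that in linarith)
    then show ?thesis by (auto simp: colourings_def p_def)
  qed
  define c where "c i = real (card (colour_class n p i))" for i
  have cL: "c i \<le> L" for i
  proof -
    have "colour_class n p i \<subseteq> {i * L..<i * L + L}"
    proof
      fix v assume "v \<in> colour_class n p i"
      then have "v div L = i" by (auto simp: colour_class_def p_def)
      then have "v = i * L + v mod L" by (metis div_mult_mod_eq)
      moreover have "v mod L < L" by (simp add: L_def)
      ultimately show "v \<in> {i * L..<i * L + L}" by auto
    qed
    then have "card (colour_class n p i) \<le> card {i * L..<i * L + L}" by (intro card_mono) auto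
    then show ?thesis by (simp add: c_def)
  qed
  have sc: "(\<Sum>i<k. c i) = n" unfolding c_def using sum_card_colour_class[OF p] by (metis of_nat_sum)
  have "(\<Sum>i<k. (c i)\<^sup>2) \<le> (\<Sum>i<k. L * c i)"
    using cL by (intro sum_mono) (auto simp: power2_eq_square c_def intro!: mult_right_mono)
  also have "\<dots> = real L * n" by (simp add: sc flip: sum_distrib_left)
  also have "real L \<le> n / k + 1" unfolding L_def by (simp add: of_nat_div_le_of_nat)
  then have "real L * n \<le> (n / k + 1) * n" by (intro mult_right_mono) auto
  also have "\<dots> = n\<^sup>2 / k + n" by (simp add: power2_eq_square algebra_simps)
  finally have "(\<Sum>i<k. (c i)\<^sup>2) \<le> n\<^sup>2 / k + n" .
  moreover have "2 * real (card (cross_pairs n p)) + (\<Sum>i<k. (c i)\<^sup>2) = real n ^ 2"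
    using arg_cong[OF card_cross_pairs[OF p], of real] by (simp add: c_def)
  ultimately show ?thesis using that[OF p] by (simp add: algebra_simps)
qed

section \<open>Concentration of the weight on balanced colourings\<close>

definition weight :: "nat \<Rightarrow> (nat \<Rightarrow> nat) set \<Rightarrow> real" where
  "weight n S = (\<Sum>p\<in>S. 2 ^ card (cross_pairs n p))"

lemma tendsto_exp_minus_square: fixes a c :: real assumes "c > 0" shows "(\<lambda>n::nat. exp (a * real n - c * (real n)\<^sup>2)) \<longlonglongrightarrow> 0"
  using assms by real_asymp

text \<open>There are at most \<open>k^n\<close> unbalanced colourings; the power of 2 is the ratio
  of the upper bound on the weight of one of them to the lower bound for an almost equitable
  colouring. Its quadratic exponent beats \<open>k^n\<close>.\<close>

lemma tendsto_unbalanced_ratio: fixes k :: nat assumes k: "k > 0"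
  shows "(\<lambda>n. real k ^ n * 2 powr (real n / 2 - (real n / (2 * real k))\<^sup>2 / 2)) \<longlonglongrightarrow> 0"
proof -
  have "real k ^ n * 2 powr (real n / 2 - (real n / (2 * real k))\<^sup>2 / 2)
      = exp ((ln k + ln 2 / 2) * real n - ln 2 / (8 * (real k)\<^sup>2) * (real n)\<^sup>2)" for n
  proof -
    have "real k ^ n = exp (real n * ln k)" using k by (simp add: exp_of_nat_mult)
    then show ?thesis using k by (simp add: powr_def power_divide power_mult_distrib field_simps flip: exp_add)
  qed
  then show ?thesis using tendsto_exp_minus_square[of "ln 2 / (8 * (real k)\<^sup>2)"] k by simp
qed

lemma weight_balanced:
  assumes k: "k > 0"
  shows "\<forall>\<^sub>F n in sequentially. weight n (colourings n k) \<le> 2 * weight n (balanced n k)"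
proof -
  have "(\<lambda>n. real k ^ n * 2 powr (real n / 2 - (real n / (2 * real k))\<^sup>2 / 2)) \<longlonglongrightarrow> 0"
    by (rule tendsto_unbalanced_ratio[OF k])
  then have "\<forall>\<^sub>F n in sequentially. real k ^ n * 2 powr (real n / 2 - (real n / (2 * real k))\<^sup>2 / 2) < 1/2"
    by (rule order_tendstoD) simp
  then show ?thesis
  proof eventually_elim
    case (elim n)
    obtain q where q: "q \<in> colourings n k" "real n ^ 2 - real n ^ 2 / k - n \<le> 2 * real (card (cross_pairs n q))"
      using ex_card_cross_large[OF k] by blast
    define U where "U = colourings n k - balanced n k"
    have "weight n U \<le> (\<Sum>p\<in>U. 2 powr ((real n ^ 2 - real n ^ 2 / k - (n / (2 * k))\<^sup>2) / 2))"
      unfolding weight_def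
    proof (rule sum_mono)
      fix p assume "p \<in> U"
      then have "real (card (cross_pairs n p)) \<le> (real n ^ 2 - real n ^ 2 / k - (n / (2 * k))\<^sup>2) / 2"
        using card_cross_unbalanced[OF k, of p n] by (simp add: U_def)
      then show "2 ^ card (cross_pairs n p) \<le> 2 powr ((real n ^ 2 - real n ^ 2 / k - (n / (2 * k))\<^sup>2) / 2)"
        by (simp flip: powr_realpow)
    qed
    also have "\<dots> = card U * 2 powr ((real n ^ 2 - real n ^ 2 / k - (n / (2 * k))\<^sup>2) / 2)" by simp
    also have "\<dots> \<le> real k ^ n * 2 powr ((real n ^ 2 - real n ^ 2 / k - (n / (2 * k))\<^sup>2) / 2)"
      using card_mono[of "colourings n k" U] by (intro mult_right_mono) (auto simp: U_def card_colourings simp flip: of_nat_power)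
    also have "\<dots> = (real k ^ n * 2 powr (real n / 2 - (real n / (2 * real k))\<^sup>2 / 2)) * 2 powr ((real n ^ 2 - real n ^ 2 / k - n) / 2)"
    proof -
      have "(real n ^ 2 - real n ^ 2 / k - (n / (2 * k))\<^sup>2) / 2
          = (real n / 2 - (real n / (2 * real k))\<^sup>2 / 2) + (real n ^ 2 - real n ^ 2 / k - n) / 2"
        by (simp add: diff_divide_distrib)
      then show ?thesis by (simp only: powr_add mult.assoc)
    qed
    also have "\<dots> \<le> 1/2 * 2 powr ((real n ^ 2 - real n ^ 2 / k - n) / 2)"
      using elim by (intro mult_right_mono) auto
    also have "2 powr ((real n ^ 2 - real n ^ 2 / k - n) / 2) \<le> 2 powr (card (cross_pairs n q))"
      using q(2) by (intro powr_mono) auto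
    also have "\<dots> = 2 ^ card (cross_pairs n q)" by (simp add: powr_realpow)
    also have "\<dots> \<le> weight n (colourings n k)" unfolding weight_def
      using q(1) by (intro member_le_sum) auto
    finally have "weight n U \<le> 1/2 * weight n (colourings n k)" by simp
    moreover have "weight n (colourings n k) = weight n U + weight n (balanced n k)"
      unfolding weight_def U_def by (rule sum.subset_diff) (auto simp: balanced_subset)
    ultimately show ?case by linarith
  qed
qed

subsection \<open>Overlap of two colourings\<close>

lemma majority_class:
  assumes k: "k > 0" and p: "p \<in> colourings n k"
  shows "\<exists>i<k. card (colour_class n q j) \<le> k * card {v \<in> colour_class n q j. p v = i}"
proof (rule ccontr)
  let ?C = "colour_class n q j"
  assume "\<not> ?thesis"
  then have lt: "k * card {v \<in> ?C. p v = i} < card ?C" if "i < k" for i using that by (auto simp: not_le)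
  have "?C = (\<Union>i<k. {v \<in> ?C. p v = i})" using colourings_less[OF p] by (auto simp: colour_class_def)
  then have "card ?C = card (\<Union>i<k. {v \<in> ?C. p v = i})" by simp
  also have "\<dots> = (\<Sum>i<k. card {v \<in> ?C. p v = i})" by (rule card_UN_disjoint) auto
  finally have "k * card ?C = (\<Sum>i<k. k * card {v \<in> ?C. p v = i})" by (simp add: sum_distrib_left)
  also have "\<dots> < (\<Sum>i<k. card ?C)" using lt k by (intro sum_strict_mono) auto
  finally show False by simp
qed

text \<open>Inside each class of \<open>q\<close> the most frequent colour of \<open>p\<close> occurs at least \<open>n / (2k\<^sup>2)\<close> times, and each vertex of
  the class with another colour forms a pair with all of these that is cross for \<open>p\<close> but not for \<open>q\<close>.\<close>

lemma majority_map:
  assumes k: "k > 0" and p: "p \<in> colourings n k" and q: "q \<in> balanced n k"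
  shows "\<exists>\<phi> \<in> {..<k} \<rightarrow>\<^sub>E {..<k}. n * card {v \<in> {1..n}. \<phi> (q v) \<noteq> p v} \<le> 2 * k\<^sup>2 * card (cross_pairs n p - cross_pairs n q)"
proof -
  obtain f where f: "\<And>j. f j < k" "\<And>j. card (colour_class n q j) \<le> k * card {v \<in> colour_class n q j. p v = f j}"
    using majority_class[OF k p, of q] by metis
  define \<phi> where "\<phi> = restrict f {..<k}"
  define D where "D = {v \<in> {1..n}. \<phi> (q v) \<noteq> p v}"
  define M where "M y = {x \<in> colour_class n q (q y). p x = f (q y)}" for y
  have qk: "q v < k" if "v \<in> {1..n}" for v using q balanced_subset colourings_less that by blast
  have fM: "finite (M y)" for y by (simp add: M_def)
  have Mlarge: "n \<le> 2 * k\<^sup>2 * card (M y)" if "y \<in> D" for y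
  proof -
    have "n \<le> 2 * k * card (colour_class n q (q y))" using q qk that by (auto simp: balanced_def D_def)
    also have "\<dots> \<le> 2 * k * (k * card (M y))" using f(2)[of "q y"] by (intro mult_left_mono) (auto simp: M_def)
    finally show ?thesis by (simp add: power2_eq_square mult_ac)
  qed
  have "n * card D = (\<Sum>y\<in>D. n)" by simp
  also have "\<dots> \<le> (\<Sum>y\<in>D. 2 * k\<^sup>2 * card (M y))" using Mlarge by (rule sum_mono)
  also have "\<dots> = 2 * k\<^sup>2 * card (Sigma D M)" using fM by (simp add: sum_distrib_left D_def)
  also have "card (Sigma D M) \<le> card (cross_pairs n p - cross_pairs n q)"
  proof (rule card_inj_on_le)
    have MD: "x \<in> {1..n}" "y \<in> {1..n}" "q x = q y" "p x = f (q y)" "p y \<noteq> f (q y)" if "(y,x) \<in> Sigma D M" for x y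
      using that qk[of y] by (auto simp: D_def M_def colour_class_def \<phi>_def)
    show "inj_on (\<lambda>(y,x). {x,y}) (Sigma D M)"
    proof (rule inj_onI)
      fix a b assume "a \<in> Sigma D M" "b \<in> Sigma D M" "(\<lambda>(y,x). {x,y}) a = (\<lambda>(y,x). {x,y}) b"
      then obtain y x y' x' where *: "a = (y,x)" "b = (y',x')" "(y,x) \<in> Sigma D M" "(y',x') \<in> Sigma D M" "{x,y} = {x',y'}"
        by (cases a, cases b) auto
      \<comment> \<open>In each pair exactly one end has the majority colour of its class, so the
        unordered pair determines the ordered one.\<close>
      have "\<not> (x = y' \<and> y = x')" using MD[OF *(3)] MD[OF *(4)] by auto
      then show "a = b" using *(1,2,5) by (auto simp: doubleton_eq_iff)
    qed
    show "(\<lambda>(y,x). {x,y}) ` Sigma D M \<subseteq> cross_pairs n p - cross_pairs n q"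
    proof
      fix e assume "e \<in> (\<lambda>(y,x). {x,y}) ` Sigma D M"
      then obtain y x where *: "(y,x) \<in> Sigma D M" "e = {x,y}" by blast
      then show "e \<in> cross_pairs n p - cross_pairs n q" using MD[OF *(1)] by (simp add: doubleton_cross_pairs)
    qed
  qed simp
  finally have "n * card D \<le> 2 * k\<^sup>2 * card (cross_pairs n p - cross_pairs n q)" by simp
  moreover have "\<phi> \<in> {..<k} \<rightarrow>\<^sub>E {..<k}" using f(1) by (auto simp: \<phi>_def)
  ultimately show ?thesis unfolding D_def by blast
qed

text \<open>If \<open>\<phi>\<close> is injective, \<open>q\<close> is determined outside \<open>D\<close>; otherwise \<open>\<phi>\<close> misses a colour and \<open>D\<close> contains a whole
  class of \<open>p\<close>, so that even the trivial bound \<open>k^n\<close> suffices.\<close>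

lemma card_colourings_with_defect:
  assumes k: "k > 0" and p: "p \<in> balanced n k" and \<phi>: "\<phi> \<in> {..<k} \<rightarrow>\<^sub>E {..<k}"
  shows "card {q \<in> colourings n k. {v \<in> {1..n}. \<phi> (q v) \<noteq> p v} = D} \<le> k ^ (2 * k * card D)"
    (is "card ?S \<le> _")
proof (cases "?S = {}")
  case False
  then have D: "D \<subseteq> {1..n}" "finite D" by (auto intro: finite_subset[of _ "{1..n}"])
  show ?thesis
  proof (cases "inj_on \<phi> {..<k}")
    case True
    have "card ?S \<le> card (D \<rightarrow>\<^sub>E {..<k})"
    proof (rule card_inj_on_le[of "\<lambda>q. restrict q D"])
      show "inj_on (\<lambda>q. restrict q D) ?S"
      proof (rule inj_onI)
        fix q q' assume q: "q \<in> ?S" "q' \<in> ?S" and eq: "restrict q D = restrict q' D"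
        show "q = q'"
        proof (rule PiE_ext[of q "{1..n}" "\<lambda>_. {..<k}" q'])
          show "q \<in> {1..n} \<rightarrow>\<^sub>E {..<k}" "q' \<in> {1..n} \<rightarrow>\<^sub>E {..<k}" using q by (auto simp: colourings_def)
          fix v assume v: "v \<in> {1..n}"
          show "q v = q' v"
          proof (cases "v \<in> D")
            case True then show ?thesis using eq by (metis restrict_apply')
          next
            case notD: False
            then have "v \<notin> {v \<in> {1..n}. \<phi> (q v) \<noteq> p v}" "v \<notin> {v \<in> {1..n}. \<phi> (q' v) \<noteq> p v}" using q by blast+
            then have "\<phi> (q v) = \<phi> (q' v)" using v by simp
            moreover have "q v < k" "q' v < k" using q v colourings_less by blast+
            ultimately show ?thesis using True by (auto simp: inj_on_def)
          qed
        qed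
      qed
      show "(\<lambda>q. restrict q D) ` ?S \<subseteq> D \<rightarrow>\<^sub>E {..<k}"
        using D colourings_less by fastforce
    qed (simp add: D finite_PiE)
    also have "\<dots> = k ^ card D" using D by (simp add: card_funcsetE)
    also have "\<dots> \<le> k ^ (2 * k * card D)" using k by (intro power_increasing) auto
    finally show ?thesis .
  next
    case False
    then have "\<not> {..<k} \<subseteq> \<phi> ` {..<k}" using finite_surj_inj by blast
    then obtain i where i: "i < k" "i \<notin> \<phi> ` {..<k}" by auto
    obtain q where q: "q \<in> colourings n k" "D = {v \<in> {1..n}. \<phi> (q v) \<noteq> p v}" using \<open>?S \<noteq> {}\<close> by auto
    have "colour_class n p i \<subseteq> D"
    proof
      fix v assume "v \<in> colour_class n p i"
      then have v: "v \<in> {1..n}" "p v = i" by (auto simp: colour_class_def)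
      then have "\<phi> (q v) \<in> \<phi> ` {..<k}" using colourings_less[OF q(1)] by blast
      then have "\<phi> (q v) \<noteq> i" using i by blast
      then show "v \<in> D" using v q by simp
    qed
    then have "card (colour_class n p i) \<le> card D" using D by (intro card_mono) auto
    then have "2 * k * card (colour_class n p i) \<le> 2 * k * card D" by simp
    then have "n \<le> 2 * k * card D" using p i by (auto simp: balanced_def intro: order_trans)
    have "card ?S \<le> card (colourings n k)" by (intro card_mono) auto
    also have "\<dots> = k ^ n" by (rule card_colourings)
    also have "\<dots> \<le> k ^ (2 * k * card D)" using k \<open>n \<le> _\<close> by (intro power_increasing) auto
    finally show ?thesis .
  qed
next
  case True
  show ?thesis unfolding True by simp
qed

text \<open>If \<open>p\<close> is balanced and \<open>n > 0\<close>, then \<open>p\<close> uses all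
  \<open>k\<close> colours, so \<open>\<phi>\<close> with \<open>\<phi> (q v) = p v\<close>
  throughout permutes them: the balanced colourings that are not far are \<open>p\<close> up to
  renaming colours.\<close>

definition far :: "nat \<Rightarrow> nat \<Rightarrow> (nat \<Rightarrow> nat) \<Rightarrow> (nat \<Rightarrow> nat) set" where
  "far n k p = {q \<in> balanced n k. \<forall>\<phi>. \<exists>v\<in>{1..n}. \<phi> (q v) \<noteq> p v}"

lemma finite_far [simp]: "finite (far n k p)"
  by (simp add: far_def)

lemma sum_power_card_Pow:
  fixes x :: real
  assumes "finite A" shows "(\<Sum>D\<in>Pow A. x ^ card D) = (1 + x) ^ card A"
  using prod_add[OF assms, of "\<lambda>_. x" "\<lambda>_. 1"] by (simp add: add.commute)

text \<open>Each \<open>q\<close> is charged to its majority map and its defect set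
  \<open>D\<close>. At most \<open>k ^ (2 * k * card D)\<close> colourings share both, and each
  loses a factor \<open>2 powr (n / (2 * k^2))\<close> per element of \<open>D\<close>;
  \<open>x\<close> combines the two effects. As \<open>D\<close> is nonempty for far
  \<open>q\<close>, the summand 1 drops out, and \<open>k^k\<close> counts the maps.\<close>

lemma sum_far:
  assumes k: "k > 0" and p: "p \<in> balanced n k"
  defines "x \<equiv> real k ^ (2 * k) * 2 powr (- (real n / (2 * (real k)\<^sup>2)))"
  shows "(\<Sum>q\<in>far n k p. 2 ^ card (cross_pairs n p \<inter> cross_pairs n q)) \<le> 2 ^ card (cross_pairs n p) * (real k ^ k * ((1 + x) ^ n - 1))"
proof -
  let ?V = "{1..n}" and ?\<Phi> = "{..<k} \<rightarrow>\<^sub>E {..<k}" and ?F = "far n k p"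
  define r :: real where "r = 2 powr (- (real n / (2 * (real k)\<^sup>2)))"
  have r: "r > 0" by (simp add: r_def)
  have pc: "p \<in> colourings n k" using p balanced_subset by blast
  have "\<forall>q\<in>?F. \<exists>\<phi>. \<phi> \<in> ?\<Phi> \<and> n * card {v \<in> ?V. \<phi> (q v) \<noteq> p v} \<le> 2 * k\<^sup>2 * card (cross_pairs n p - cross_pairs n q)"
    using majority_map[OF k pc] unfolding far_def by blast
  from bchoice[OF this] obtain \<phi> where \<phi>: "\<And>q. q \<in> ?F \<Longrightarrow> \<phi> q \<in> ?\<Phi>"
    "\<And>q. q \<in> ?F \<Longrightarrow> n * card {v \<in> ?V. \<phi> q (q v) \<noteq> p v} \<le> 2 * k\<^sup>2 * card (cross_pairs n p - cross_pairs n q)"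
    by blast
  define D where "D q = {v \<in> ?V. \<phi> q (q v) \<noteq> p v}" for q
  define g where "g q = (\<phi> q, D q)" for q
  have term_le: "2 ^ card (cross_pairs n p \<inter> cross_pairs n q) \<le> 2 ^ card (cross_pairs n p) * r ^ card (D q)" if q: "q \<in> ?F" for q
  proof -
    let ?d = "card (cross_pairs n p - cross_pairs n q)"
    have "card (cross_pairs n p) = card (cross_pairs n p \<inter> cross_pairs n q) + ?d"
      by (metis Int_Diff_disjoint Int_Diff_Un card_Un_disjoint finite_Diff finite_Int finite_cross_pairs)
    then have "2 ^ card (cross_pairs n p \<inter> cross_pairs n q) = 2 ^ card (cross_pairs n p) * (2 powr (- real ?d))"
      by (simp add: power_add powr_minus powr_realpow)
    also have "real n * real (card (D q)) \<le> 2 * (real k)\<^sup>2 * real ?d"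
      using \<phi>(2)[OF q] unfolding D_def by (metis (mono_tags) of_nat_mono of_nat_mult of_nat_numeral of_nat_power)
    then have "real n / (2 * (real k)\<^sup>2) * card (D q) \<le> ?d" using k by (simp add: field_simps)
    then have "2 powr (- real ?d) \<le> 2 powr (- (real n / (2 * (real k)\<^sup>2)) * card (D q))"
      by (intro powr_mono) auto
    also have "\<dots> = r ^ card (D q)" using powr_powr[of 2] by (simp add: r_def flip: powr_realpow)
    finally show ?thesis by simp
  qed
  have "(\<Sum>q\<in>?F. 2 ^ card (cross_pairs n p \<inter> cross_pairs n q)) \<le> (\<Sum>q\<in>?F. 2 ^ card (cross_pairs n p) * r ^ card (D q))"
    using term_le by (rule sum_mono)
  also have "\<dots> = (\<Sum>y\<in>g ` ?F. \<Sum>q\<in>{q \<in> ?F. g q = y}. 2 ^ card (cross_pairs n p) * r ^ card (D q))"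
    by (rule sum.image_gen) simp
  also have "\<dots> \<le> (\<Sum>y\<in>g ` ?F. 2 ^ card (cross_pairs n p) * x ^ card (snd y))"
  proof (rule sum_mono)
    fix y assume "y \<in> g ` ?F"
    then obtain q0 where "q0 \<in> ?F" "y = g q0" by blast
    then have y: "fst y \<in> ?\<Phi>" using \<phi>(1)[of q0] by (simp add: g_def)
    have "{q \<in> ?F. g q = y} \<subseteq> {q \<in> colourings n k. {v \<in> {1..n}. fst y (q v) \<noteq> p v} = snd y}"
    proof
      fix q assume "q \<in> {q \<in> ?F. g q = y}"
      then have q: "q \<in> ?F" "fst y = \<phi> q" "snd y = D q" by (auto simp only: mem_Collect_eq g_def fst_conv snd_conv)
      have "q \<in> colourings n k" using q(1) balanced_subset unfolding far_def by blast
      then show "q \<in> {q \<in> colourings n k. {v \<in> {1..n}. fst y (q v) \<noteq> p v} = snd y}"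
        unfolding q(2,3) D_def by simp
    qed
    then have "card {q \<in> ?F. g q = y} \<le> card {q \<in> colourings n k. {v \<in> {1..n}. fst y (q v) \<noteq> p v} = snd y}"
      by (intro card_mono) auto
    also have "\<dots> \<le> k ^ (2 * k * card (snd y))" by (rule card_colourings_with_defect[OF k p y])
    finally have c: "real (card {q \<in> ?F. g q = y}) \<le> real k ^ (2 * k * card (snd y))"
      by (simp only: of_nat_power[symmetric] of_nat_le_iff)
    have "(\<Sum>q\<in>{q \<in> ?F. g q = y}. 2 ^ card (cross_pairs n p) * r ^ card (D q)) = (\<Sum>q\<in>{q \<in> ?F. g q = y}. 2 ^ card (cross_pairs n p) * r ^ card (snd y))"
      by (rule sum.cong) (auto simp: g_def)
    also have "\<dots> = card {q \<in> ?F. g q = y} * (2 ^ card (cross_pairs n p) * r ^ card (snd y))" by simp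
    also have "\<dots> \<le> real k ^ (2 * k * card (snd y)) * (2 ^ card (cross_pairs n p) * r ^ card (snd y))"
      using c r by (intro mult_right_mono) auto
    also have "\<dots> = 2 ^ card (cross_pairs n p) * x ^ card (snd y)"
      by (simp add: x_def r_def[symmetric] power_mult_distrib power_mult)
    finally show "(\<Sum>q\<in>{q \<in> ?F. g q = y}. 2 ^ card (cross_pairs n p) * r ^ card (D q)) \<le> 2 ^ card (cross_pairs n p) * x ^ card (snd y)" .
  qed
  also have "\<dots> \<le> (\<Sum>y\<in>?\<Phi> \<times> (Pow ?V - {{}}). 2 ^ card (cross_pairs n p) * x ^ card (snd y))"
  proof (rule sum_mono2)
    show "g ` ?F \<subseteq> ?\<Phi> \<times> (Pow ?V - {{}})"
    proof
      fix y assume "y \<in> g ` ?F"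
      then obtain q where q: "q \<in> ?F" "y = g q" by blast
      have "\<exists>v\<in>?V. \<phi> q (q v) \<noteq> p v" using q(1) unfolding far_def by simp
      then have "D q \<noteq> {}" unfolding D_def by blast
      moreover have "D q \<subseteq> ?V" by (auto simp: D_def)
      ultimately show "y \<in> ?\<Phi> \<times> (Pow ?V - {{}})" using q(2) \<phi>(1)[OF q(1)] by (simp add: g_def)
    qed
  qed (auto simp: finite_PiE x_def)
  also have "\<dots> = 2 ^ card (cross_pairs n p) * (real k ^ k * (\<Sum>D\<in>Pow ?V - {{}}. x ^ card D))"
  proof -
    have "(\<Sum>y\<in>?\<Phi> \<times> (Pow ?V - {{}}). 2 ^ card (cross_pairs n p) * x ^ card (snd y))
        = (\<Sum>\<psi>\<in>?\<Phi>. \<Sum>D\<in>Pow ?V - {{}}. 2 ^ card (cross_pairs n p) * x ^ card D)"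
      unfolding sum.cartesian_product by (simp only: split_def)
    then show ?thesis by (simp add: card_funcsetE sum_distrib_left mult_ac)
  qed
  also have "(\<Sum>D\<in>Pow ?V - {{}}. x ^ card D) = (1 + x) ^ n - 1"
    using sum_power_card_Pow[of ?V x] by (simp add: sum_diff1)
  finally show ?thesis .
qed

subsection \<open>Counting exotic graphs\<close>

definition pairs_between :: "nat set \<Rightarrow> nat set \<Rightarrow> nat set set" where
  "pairs_between e f = (\<lambda>(u,v). {u,v}) ` (e \<times> f)"

definition exotic :: "nat \<Rightarrow> (nat \<Rightarrow> nat) \<Rightarrow> nat set \<Rightarrow> nat set \<Rightarrow> nat set set set" where
  "exotic n p e f = (\<lambda>E. insert e (insert f E)) ` Pow (cross_pairs n p - pairs_between e f)"

definition exotic_index :: "nat \<Rightarrow> nat \<Rightarrow> ((nat \<Rightarrow> nat) \<times> nat set \<times> nat set) set" where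
  "exotic_index n k = (SIGMA p:balanced n k. nsets (colour_class n p 0) 2 \<times> nsets (colour_class n p 1) 2)"

definition exotic_union :: "nat \<Rightarrow> nat \<Rightarrow> nat set set set" where
  "exotic_union n k = (\<Union>(p,e,f)\<in>exotic_index n k. exotic n p e f)"

lemma finite_exotic [simp]: "finite (exotic n p e f)"
  by (simp add: exotic_def)

lemma finite_exotic_index [simp]: "finite (exotic_index n k)"
  by (auto simp: exotic_index_def finite_imp_finite_nsets)

lemma finite_exotic_union [simp]: "finite (exotic_union n k)"
  by (auto simp: exotic_union_def)

lemma nsets_colour_class_inner: "nsets (colour_class n p i) 2 \<subseteq> inner_pairs n p"
proof
  fix e assume "e \<in> nsets (colour_class n p i) 2"
  then have "e \<in> nsets {1..n} 2" "\<forall>v\<in>e. p v = i" by (auto simp: nsets_def colour_class_def)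
  then show "e \<in> inner_pairs n p" unfolding inner_pairs_def by blast
qed

lemma exotic_inner:
  assumes "e \<in> inner_pairs n p" "f \<in> inner_pairs n p" "G \<in> exotic n p e f"
  shows "G \<inter> inner_pairs n p = {e,f}" "G \<subseteq> nsets {1..n} 2"
  using assms cross_Un_inner_pairs[of n p] by (auto simp: exotic_def)

text \<open>At most four pairs lie between \<open>e\<close> and \<open>f\<close>, whence
  \<open>16 = 2^4\<close>.\<close>

lemma card_exotic:
  assumes ef: "e \<in> inner_pairs n p" "f \<in> inner_pairs n p"
  shows "2 ^ card (cross_pairs n p) \<le> 16 * card (exotic n p e f)"
proof -
  have inj: "inj_on (\<lambda>E. insert e (insert f E)) (Pow (cross_pairs n p - pairs_between e f))"
  proof (rule inj_on_inverseI)
    fix E assume "E \<in> Pow (cross_pairs n p - pairs_between e f)"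
    then show "insert e (insert f E) \<inter> cross_pairs n p = E" using ef cross_Un_inner_pairs(2) by blast
  qed
  have c2: "finite e" "finite f" "card e = 2" "card f = 2" using ef by (auto simp: inner_pairs_def nsets_def)
  have "card (pairs_between e f) \<le> card (e \<times> f)" unfolding pairs_between_def using c2 by (intro card_image_le) auto
  then have "card (pairs_between e f) \<le> 4" using c2 by (simp add: card_cartesian_product)
  moreover have "card (cross_pairs n p) - card (pairs_between e f) \<le> card (cross_pairs n p - pairs_between e f)"
    by (rule diff_card_le_card_Diff) (simp add: pairs_between_def c2)
  ultimately have "card (cross_pairs n p) \<le> 4 + card (cross_pairs n p - pairs_between e f)" by linarith
  then have "(2::nat) ^ card (cross_pairs n p) \<le> 2 ^ (4 + card (cross_pairs n p - pairs_between e f))" by (intro power_increasing) auto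
  also have "\<dots> = 16 * card (exotic n p e f)" by (simp add: exotic_def card_image[OF inj] card_Pow power_add)
  finally show ?thesis .
qed

text \<open>On pairs that are inner for \<open>p\<close> or for \<open>q\<close> the graph is
  prescribed; only pairs that are cross for both remain free.\<close>

lemma card_exotic_Int:
  assumes "e \<in> inner_pairs n p" "f \<in> inner_pairs n p" "e' \<in> inner_pairs n q" "f' \<in> inner_pairs n q"
  shows "card (exotic n p e f \<inter> exotic n q e' f') \<le> 2 ^ card (cross_pairs n p \<inter> cross_pairs n q)"
proof -
  have "card (exotic n p e f \<inter> exotic n q e' f') \<le> card (Pow (cross_pairs n p \<inter> cross_pairs n q))"
  proof (rule card_inj_on_le[of "\<lambda>G. G \<inter> (cross_pairs n p \<inter> cross_pairs n q)"])
    show "inj_on (\<lambda>G. G \<inter> (cross_pairs n p \<inter> cross_pairs n q)) (exotic n p e f \<inter> exotic n q e' f')"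
    proof (rule inj_on_inverseI)
      fix G assume G: "G \<in> exotic n p e f \<inter> exotic n q e' f'"
      have *: "{e,f} = G \<inter> inner_pairs n p" "{e',f'} = G \<inter> inner_pairs n q" "G \<subseteq> nsets {1..n} 2"
        using exotic_inner[OF assms(1,2), of G] exotic_inner[OF assms(3,4), of G] G by simp_all
      have "G \<inter> (cross_pairs n p \<inter> cross_pairs n q) \<union> G \<inter> inner_pairs n p \<union> G \<inter> inner_pairs n q = G"
        using *(3) unfolding cross_pairs_def by blast
      then show "(\<lambda>X. X \<union> {e,f} \<union> {e',f'}) (G \<inter> (cross_pairs n p \<inter> cross_pairs n q)) = G"
        unfolding * .
    qed
  qed auto
  also have "\<dots> = 2 ^ card (cross_pairs n p \<inter> cross_pairs n q)" by (rule card_Pow) simp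
  finally show ?thesis .
qed

text \<open>Discarding the graphs that also arise from a far colouring loses at most half of them and makes the
  number of representations of the remaining ones bounded.\<close>

definition exotic_proper :: "nat \<Rightarrow> nat \<Rightarrow> (nat \<Rightarrow> nat) \<Rightarrow> nat set \<Rightarrow> nat set \<Rightarrow> nat set set set" where
  "exotic_proper n k p e f = exotic n p e f - (\<Union>q\<in>far n k p. \<Union>e'\<in>inner_pairs n q. \<Union>f'\<in>inner_pairs n q. exotic n q e' f')"

lemma card_inner_le: "card (inner_pairs n q) \<le> n\<^sup>2"
proof -
  have "card (inner_pairs n q) \<le> card (nsets {1..n} 2)" by (intro card_mono) (auto simp: inner_pairs_def finite_imp_finite_nsets)
  also have "\<dots> = n choose 2" by simp
  also have "\<dots> \<le> n\<^sup>2" using two_choose_two[of n] by linarith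
  finally show ?thesis .
qed

text \<open>The factor \<open>n^4\<close> bounds the choices of \<open>e'\<close> and
  \<open>f'\<close> for each far \<open>q\<close>, and \<open>1/32\<close> is half of the
  \<open>1/16\<close> from \<open>card_exotic\<close>.\<close>

lemma card_exotic_proper:
  assumes ef: "e \<in> inner_pairs n p" "f \<in> inner_pairs n p"
    and sm: "real n ^ 4 * (\<Sum>q\<in>far n k p. 2 ^ card (cross_pairs n p \<inter> cross_pairs n q)) \<le> 2 ^ card (cross_pairs n p) / 32"
  shows "2 ^ card (cross_pairs n p) / 32 \<le> real (card (exotic_proper n k p e f))"
proof -
  let ?A = "exotic n p e f"
  let ?B = "\<Union>q\<in>far n k p. \<Union>e'\<in>inner_pairs n q. \<Union>f'\<in>inner_pairs n q. exotic n q e' f'"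
  have "card (?A \<inter> ?B) \<le> (\<Sum>q\<in>far n k p. n ^ 4 * 2 ^ card (cross_pairs n p \<inter> cross_pairs n q))"
  proof -
    have "?A \<inter> ?B = (\<Union>q\<in>far n k p. \<Union>e'\<in>inner_pairs n q. \<Union>f'\<in>inner_pairs n q. ?A \<inter> exotic n q e' f')" by blast
    also have "card \<dots> \<le> (\<Sum>q\<in>far n k p. card (\<Union>e'\<in>inner_pairs n q. \<Union>f'\<in>inner_pairs n q. ?A \<inter> exotic n q e' f'))"
      by (rule card_UN_le) simp
    also have "\<dots> \<le> (\<Sum>q\<in>far n k p. n ^ 4 * 2 ^ card (cross_pairs n p \<inter> cross_pairs n q))"
    proof (rule sum_mono)
      fix q
      let ?c = "2 ^ card (cross_pairs n p \<inter> cross_pairs n q) :: nat"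
      have "card (\<Union>e'\<in>inner_pairs n q. \<Union>f'\<in>inner_pairs n q. ?A \<inter> exotic n q e' f') \<le> (\<Sum>e'\<in>inner_pairs n q. card (\<Union>f'\<in>inner_pairs n q. ?A \<inter> exotic n q e' f'))"
        by (rule card_UN_le) simp
      also have "\<dots> \<le> (\<Sum>e'\<in>inner_pairs n q. \<Sum>f'\<in>inner_pairs n q. card (?A \<inter> exotic n q e' f'))"
        by (intro sum_mono card_UN_le) simp
      also have "\<dots> \<le> (\<Sum>e'\<in>inner_pairs n q. \<Sum>f'\<in>inner_pairs n q. ?c)"
        by (intro sum_mono card_exotic_Int ef)
      also have "\<dots> = card (inner_pairs n q) * card (inner_pairs n q) * ?c" by simp
      also have "\<dots> \<le> n\<^sup>2 * n\<^sup>2 * ?c" by (intro mult_right_mono mult_mono card_inner_le) auto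
      finally show "card (\<Union>e'\<in>inner_pairs n q. \<Union>f'\<in>inner_pairs n q. ?A \<inter> exotic n q e' f') \<le> n ^ 4 * ?c"
        by (simp flip: power_add)
    qed
    finally show ?thesis .
  qed
  then have "real (card (?A \<inter> ?B)) \<le> real n ^ 4 * (\<Sum>q\<in>far n k p. 2 ^ card (cross_pairs n p \<inter> cross_pairs n q))"
    by (simp add: sum_distrib_left flip: of_nat_le_iff[where 'a=real])
  moreover have "real (card ?A) = real (card (?A \<inter> ?B)) + real (card (exotic_proper n k p e f))"
    using card_Int_Diff[OF finite_exotic, of n p e f ?B] unfolding exotic_proper_def of_nat_add[symmetric] of_nat_eq_iff .
  moreover have "2 ^ card (cross_pairs n p) \<le> 16 * real (card ?A)"
    using card_exotic[OF ef] by (simp flip: of_nat_le_iff[where 'a=real])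
  ultimately show ?thesis using sm by linarith
qed

text \<open>Any two colourings representing \<open>G\<close> differ by a renaming, hence have the
  same inner pairs and the same set \<open>{e,f}\<close>. There are at most \<open>k^k\<close>
  renamings, and \<open>e\<close> and \<open>f\<close> have two candidates each.\<close>

lemma exotic_multiplicity:
  assumes k: "k > 0" and n: "n > 0"
  shows "card {(p,e,f) \<in> exotic_index n k. G \<in> exotic_proper n k p e f} \<le> 4 * k ^ k"
proof (cases "\<exists>p e f. (p,e,f) \<in> exotic_index n k \<and> G \<in> exotic_proper n k p e f")
  case False
  then have E: "{(p,e,f) \<in> exotic_index n k. G \<in> exotic_proper n k p e f} = {}" by auto
  show ?thesis unfolding E by simp
next
  case True
  then obtain p0 e0 f0 where t0: "(p0,e0,f0) \<in> exotic_index n k" "G \<in> exotic_proper n k p0 e0 f0" by blast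
  have idx: "p \<in> balanced n k" "e \<in> inner_pairs n p" "f \<in> inner_pairs n p" if "(p,e,f) \<in> exotic_index n k" for p e f
    using that nsets_colour_class_inner by (fastforce simp: exotic_index_def)+
  let ?V = "{1..n}" and ?\<Phi> = "{..<k} \<rightarrow>\<^sub>E {..<k}"
  let ?T = "{(p,e,f) \<in> exotic_index n k. G \<in> exotic_proper n k p e f}"
  have p0V: "\<exists>v\<in>?V. p0 v = i" if "i < k" for i
  proof -
    have "n \<le> 2 * k * card (colour_class n p0 i)" using idx(1)[OF t0(1)] that by (simp add: balanced_def)
    then have "colour_class n p0 i \<noteq> {}" using n by auto
    then show ?thesis by (auto simp: colour_class_def)
  qed
  have "?T \<subseteq> (\<lambda>(\<psi>,e,f). (restrict (\<lambda>v. \<psi> (p0 v)) ?V, e, f)) ` (?\<Phi> \<times> {e0,f0} \<times> {e0,f0})"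
  proof
    fix \<tau> assume "\<tau> \<in> ?T"
    then obtain p e f where \<tau>: "\<tau> = (p,e,f)" and t: "(p,e,f) \<in> exotic_index n k" "G \<in> exotic_proper n k p e f" by blast
    have Gp: "G \<in> exotic n p e f" "G \<in> exotic n p0 e0 f0" using t(2) t0(2) by (auto simp: exotic_proper_def)
    have "p \<notin> far n k p0"
    proof
      assume "p \<in> far n k p0"
      then have "G \<in> (\<Union>q\<in>far n k p0. \<Union>e'\<in>inner_pairs n q. \<Union>f'\<in>inner_pairs n q. exotic n q e' f')"
        using Gp(1) idx[OF t(1)] by blast
      then show False using t0(2) unfolding exotic_proper_def by blast
    qed
    then obtain \<phi> where \<phi>: "\<forall>v\<in>?V. \<phi> (p v) = p0 v" using idx(1)[OF t(1)] unfolding far_def by blast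
    have pc: "p \<in> colourings n k" using idx(1)[OF t(1)] balanced_subset by blast
    have surj: "{..<k} \<subseteq> \<phi> ` {..<k}"
    proof
      fix i assume "i \<in> {..<k}"
      then have "\<exists>v\<in>?V. p0 v = i" by (intro p0V) simp
      then obtain v where v: "v \<in> ?V" "p0 v = i" by blast
      then have "\<phi> (p v) = i" "p v < k" using \<phi> colourings_less[OF pc] by auto
      then show "i \<in> \<phi> ` {..<k}" by auto
    qed
    then have inj: "inj_on \<phi> {..<k}" by (intro finite_surj_inj) auto
    define \<psi> where "\<psi> = restrict (inv_into {..<k} \<phi>) {..<k}"
    have \<psi>: "\<psi> \<in> ?\<Phi>" using surj inv_into_into[of _ \<phi> "{..<k}"] by (auto simp: \<psi>_def)
    have p0k: "p0 v < k" if "v \<in> ?V" for v using idx(1)[OF t0(1)] balanced_subset colourings_less that by blast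
    have pv: "p v = \<psi> (p0 v)" if "v \<in> ?V" for v
    proof -
      have "inv_into {..<k} \<phi> (\<phi> (p v)) = p v" using inj colourings_less[OF pc that] by simp
      then show ?thesis using \<phi> that p0k[OF that] by (simp add: \<psi>_def)
    qed
    have "p = restrict (\<lambda>v. \<psi> (p0 v)) ?V"
    proof
      fix v show "p v = restrict (\<lambda>v. \<psi> (p0 v)) ?V v"
        using pv[of v] pc by (cases "v \<in> ?V") (auto simp: colourings_def PiE_def extensional_def)
    qed
    moreover have "inner_pairs n p = inner_pairs n p0"
    proof -
      have iff: "p u = p v \<longleftrightarrow> p0 u = p0 v" if "u \<in> ?V" "v \<in> ?V" for u v
        using that pv[OF that(1)] pv[OF that(2)] \<phi> by metis
      have "{u,v} \<in> inner_pairs n p \<longleftrightarrow> {u,v} \<in> inner_pairs n p0" for u v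
        unfolding doubleton_inner_pairs using iff[of u v] by blast
      moreover have "\<exists>u v. x = {u,v}" if "x \<in> inner_pairs n q" for x q
        using that by (auto simp: inner_pairs_def nsets_def card_2_iff)
      ultimately show ?thesis by blast
    qed
    then have "{e,f} = {e0,f0}"
      using exotic_inner(1)[OF idx(2,3)[OF t(1)] Gp(1)] exotic_inner(1)[OF idx(2,3)[OF t0(1)] Gp(2)] by simp
    then have "e \<in> {e0,f0}" "f \<in> {e0,f0}" by blast+
    ultimately show "\<tau> \<in> (\<lambda>(\<psi>,e,f). (restrict (\<lambda>v. \<psi> (p0 v)) ?V, e, f)) ` (?\<Phi> \<times> {e0,f0} \<times> {e0,f0})"
      unfolding \<tau> using \<psi> by (intro image_eqI[of _ _ "(\<psi>,e,f)"]) auto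
  qed
  then have "card ?T \<le> card ((\<lambda>(\<psi>,e,f). (restrict (\<lambda>v. \<psi> (p0 v)) ?V, e, f)) ` (?\<Phi> \<times> {e0,f0} \<times> {e0,f0}))"
    by (intro card_mono) (auto simp: finite_PiE)
  also have "\<dots> \<le> card (?\<Phi> \<times> {e0,f0} \<times> {e0,f0})" by (intro card_image_le) (auto simp: finite_PiE)
  also have "\<dots> = k ^ k * (card {e0,f0} * card {e0,f0})" unfolding card_cartesian_product by (simp add: card_funcsetE)
  also have "\<dots> \<le> k ^ k * (2 * 2)" by (intro mult_left_mono mult_mono) (auto simp: card_insert_if)
  finally show ?thesis by simp
qed

section \<open>Lower bound for the number of exotic graphs\<close>

text \<open>The bound \<open>4 * k \<le> n\<close> gives \<open>c \<ge> 2\<close>, hence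
  \<open>c choose 2\<close> is at least \<open>c^2 / 4\<close>.\<close>

lemma choose_two_large:
  assumes c: "real n \<le> 2 * k * c" and n: "4 * k \<le> n" and k: "k > 0"
  shows "(real n)\<^sup>2 / (16 * (real k)\<^sup>2) \<le> real (c choose 2)"
proof -
  have "n \<le> 2 * k * c" using c of_nat_le_iff[of n "2 * k * c", where 'a = real] by simp
  then have "2 * k * 2 \<le> 2 * k * c" using n by linarith
  then have c2: "2 \<le> c" using k by simp
  have "real n / (2 * k) \<le> c" using c k by (simp add: field_simps)
  then have "(real n / (2 * k))\<^sup>2 \<le> (real c)\<^sup>2" by (intro power_mono) auto
  also have "(real c)\<^sup>2 = 2 * real (c choose 2) + real c" using arg_cong[OF two_choose_two[of c], of real] by simp
  finally have 1: "(real n / (2 * k))\<^sup>2 \<le> 2 * real (c choose 2) + real c" .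
  have "2 * c \<le> c\<^sup>2" using c2 by (simp add: power2_eq_square)
  then have "c \<le> 2 * (c choose 2)" using two_choose_two[of c] by linarith
  then have "real c \<le> 2 * real (c choose 2)" by linarith
  then have "(real n / (2 * k))\<^sup>2 \<le> 4 * real (c choose 2)" using 1 by linarith
  then show ?thesis by (simp add: power_divide power_mult_distrib)
qed

text \<open>Double counting of incidences between index triples and graphs: each triple has many
  proper graphs, and each graph belongs to few triples.\<close>

lemma card_exotic_union_at:
  assumes k: "2 \<le> k" and n: "4 * k \<le> n"
    and sm: "\<And>p. p \<in> balanced n k \<Longrightarrow>
      real n ^ 4 * (\<Sum>q\<in>far n k p. 2 ^ card (cross_pairs n p \<inter> cross_pairs n q)) \<le> 2 ^ card (cross_pairs n p) / 32"
  shows "((real n)\<^sup>2 / (16 * (real k)\<^sup>2))\<^sup>2 * weight n (balanced n k) / 32 \<le> 4 * real k ^ k * card (exotic_union n k)"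
proof -
  let ?I = "exotic_index n k" and ?U = "exotic_union n k"
  let ?P = "\<lambda>(p,e,f). exotic_proper n k p e f"
  let ?b = "(real n)\<^sup>2 / (16 * (real k)\<^sup>2)"
  have PU: "?P \<tau> \<subseteq> ?U" if "\<tau> \<in> ?I" for \<tau>
    using that unfolding exotic_union_def exotic_proper_def by fastforce
  have "?b\<^sup>2 * weight n (balanced n k) / 32 = (\<Sum>p\<in>balanced n k. ?b * ?b * (2 ^ card (cross_pairs n p) / 32))"
    by (simp add: weight_def sum_distrib_left sum_divide_distrib power2_eq_square)
  also have "\<dots> \<le> (\<Sum>p\<in>balanced n k. real (card (nsets (colour_class n p 0) 2 \<times> nsets (colour_class n p 1) 2)) * (2 ^ card (cross_pairs n p) / 32))"
  proof (rule sum_mono)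
    fix p assume p: "p \<in> balanced n k"
    have b: "?b \<le> real (card (nsets (colour_class n p i) 2))" if "i < k" for i
    proof -
      have "n \<le> 2 * k * card (colour_class n p i)" using p that by (simp add: balanced_def)
      then have "real n \<le> 2 * k * card (colour_class n p i)" by linarith
      then show ?thesis using choose_two_large[OF _ n, of "card (colour_class n p i)"] k by simp
    qed
    have "?b * ?b \<le> real (card (nsets (colour_class n p 0) 2)) * real (card (nsets (colour_class n p 1) 2))"
      using b[of 0] b[of 1] k by (intro mult_mono) auto
    then show "?b * ?b * (2 ^ card (cross_pairs n p) / 32) \<le> real (card (nsets (colour_class n p 0) 2 \<times> nsets (colour_class n p 1) 2)) * (2 ^ card (cross_pairs n p) / 32)"
      by (intro mult_right_mono) (auto simp: card_cartesian_product)
  qed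
  also have "\<dots> = (\<Sum>p\<in>balanced n k. \<Sum>y\<in>nsets (colour_class n p 0) 2 \<times> nsets (colour_class n p 1) 2. 2 ^ card (cross_pairs n p) / 32)"
    by (simp only: sum_constant)
  also have "\<dots> = (\<Sum>(p,y)\<in>?I. 2 ^ card (cross_pairs n p) / 32)"
    unfolding exotic_index_def by (rule sum.Sigma) (auto simp: finite_imp_finite_nsets)
  also have "\<dots> \<le> (\<Sum>\<tau>\<in>?I. real (card (?P \<tau>)))"
  proof (rule sum_mono)
    fix \<tau> assume t: "\<tau> \<in> ?I"
    obtain p e f where \<tau>: "\<tau> = (p,e,f)" by (cases \<tau>)
    have pb: "p \<in> balanced n k" "e \<in> inner_pairs n p" "f \<in> inner_pairs n p"
      using t nsets_colour_class_inner unfolding \<tau> by (fastforce simp: exotic_index_def)+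
    show "(case \<tau> of (p,y) \<Rightarrow> 2 ^ card (cross_pairs n p) / 32) \<le> real (card (?P \<tau>))"
      unfolding \<tau> prod.case by (rule card_exotic_proper[OF pb(2,3) sm[OF pb(1)]])
  qed
  also have "\<dots> = real (\<Sum>\<tau>\<in>?I. card {G \<in> ?U. G \<in> ?P \<tau>})"
    using PU by (simp add: Collect_conj_eq Int_absorb1)
  also have "(\<Sum>\<tau>\<in>?I. card {G \<in> ?U. G \<in> ?P \<tau>}) = (\<Sum>G\<in>?U. card {\<tau> \<in> ?I. G \<in> ?P \<tau>})"
    by (rule sum_multicount_gen[symmetric]) auto
  also have "\<dots> \<le> (\<Sum>G\<in>?U. 4 * k ^ k)"
  proof (rule sum_mono)
    fix G
    have "{\<tau> \<in> ?I. G \<in> ?P \<tau>} = {(p,e,f) \<in> ?I. G \<in> exotic_proper n k p e f}" by auto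
    then show "card {\<tau> \<in> ?I. G \<in> ?P \<tau>} \<le> 4 * k ^ k" using exotic_multiplicity[of k n G] k n by simp
  qed
  finally show ?thesis by (simp add: mult_ac)
qed

lemma tendsto_pow5_exp_minus:
  fixes c :: real
  assumes "c > 0" shows "(\<lambda>n::nat. (real n)^5 * exp (- c * real n)) \<longlonglongrightarrow> 0"
  using assms by real_asymp

lemma one_plus_power_le:
  fixes x :: real
  assumes x: "0 \<le> x" "real n * x \<le> 1"
  shows "(1 + x) ^ n - 1 \<le> 2 * (real n * x)"
proof -
  have "(1 + x) ^ n \<le> exp x ^ n" using x by (intro power_mono) auto
  also have "\<dots> = exp (real n * x)" by (simp add: exp_of_nat_mult)
  also have "\<dots> \<le> 1 + real n * x + (real n * x)\<^sup>2" using x by (intro exp_bound) auto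
  also have "(real n * x)\<^sup>2 \<le> real n * x" using x mult_left_le[of "real n * x" "real n * x"] by (simp add: power2_eq_square)
  finally show ?thesis by linarith
qed

text \<open>With \<open>x\<close> as in \<open>sum_far\<close>, exponentially small in
  \<open>n\<close>, \<open>(1 + x)^n - 1\<close> is at most \<open>2 * n * x\<close>, so everything
  reduces to \<open>n^5 * x\<close>. Smallness of that one quantity also yields the condition
  \<open>n * x \<le> 1\<close>.\<close>

lemma eventually_sum_far:
  assumes k: "k > 0"
  shows "\<forall>\<^sub>F n in sequentially. \<forall>p\<in>balanced n k.
    real n ^ 4 * (\<Sum>q\<in>far n k p. 2 ^ card (cross_pairs n p \<inter> cross_pairs n q)) \<le> 2 ^ card (cross_pairs n p) / 32"
proof -
  define c where "c = ln 2 / (2 * (real k)\<^sup>2)"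
  define A where "A = 2 * real k ^ k * real k ^ (2 * k)"
  have c: "c > 0" using k by (simp add: c_def)
  have "(\<lambda>n. A * ((real n)^5 * exp (- c * real n))) \<longlonglongrightarrow> A * 0"
    by (intro tendsto_intros tendsto_pow5_exp_minus c)
  then have "\<forall>\<^sub>F n in sequentially. A * ((real n)^5 * exp (- c * real n)) < 1/64"
    by (rule order_tendstoD(2)) simp
  then show ?thesis using eventually_ge_at_top[of 1]
  proof eventually_elim
    case (elim n)
    define x where "x = real k ^ (2 * k) * 2 powr (- (real n / (2 * (real k)\<^sup>2)))"
    have x: "x = real k ^ (2 * k) * exp (- c * real n)" by (simp add: x_def c_def powr_def)
    have small: "2 * real k ^ k * x * real n ^ 5 < 1/64" using elim(1) by (simp add: x A_def mult_ac)
    have x0: "0 \<le> x" by (simp add: x)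
    have kk: "1 \<le> real k ^ k" using k by simp
    have "real n * x \<le> 2 * real k ^ k * x * real n ^ 5"
    proof -
      have "real n ^ 1 \<le> real n ^ 5" using elim(2) by (intro power_increasing) auto
      then have "x * real n \<le> x * real n ^ 5" using x0 by (intro mult_left_mono) auto
      also have "\<dots> \<le> 2 * real k ^ k * (x * real n ^ 5)"
      proof -
        have "1 * (x * real n ^ 5) \<le> (2 * real k ^ k) * (x * real n ^ 5)"
          using kk x0 by (intro mult_right_mono) auto
        then show ?thesis by simp
      qed
      finally show ?thesis by (simp add: mult_ac)
    qed
    then have "real n * x \<le> 1" using small by linarith
    then have pw: "(1 + x) ^ n - 1 \<le> 2 * (real n * x)" using one_plus_power_le x0 by blast
    show ?case
    proof
      fix p assume p: "p \<in> balanced n k"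
      have "real n ^ 4 * (\<Sum>q\<in>far n k p. 2 ^ card (cross_pairs n p \<inter> cross_pairs n q)) \<le> real n ^ 4 * (2 ^ card (cross_pairs n p) * (real k ^ k * ((1 + x) ^ n - 1)))"
        using sum_far[OF k p] unfolding x_def by (intro mult_left_mono) auto
      also have "\<dots> \<le> real n ^ 4 * (2 ^ card (cross_pairs n p) * (real k ^ k * (2 * (real n * x))))"
        using pw by (intro mult_left_mono) auto
      also have "\<dots> = 2 ^ card (cross_pairs n p) * (2 * real k ^ k * x * real n ^ 5)"
        by (simp add: numeral_eq_Suc mult_ac)
      also have "\<dots> \<le> 2 ^ card (cross_pairs n p) * (1/32)" using small by (intro mult_left_mono) auto
      finally show "real n ^ 4 * (\<Sum>q\<in>far n k p. 2 ^ card (cross_pairs n p \<inter> cross_pairs n q)) \<le> 2 ^ card (cross_pairs n p) / 32"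
        by simp
    qed
  qed
qed

lemma eventually_card_exotic_union:
  assumes k: "2 \<le> k"
  obtains c :: real where "c > 0"
    "\<forall>\<^sub>F n in sequentially. c * real n ^ 4 * weight n (colourings n k) \<le> card (exotic_union n k)"
proof -
  \<comment> \<open>The constant is \<open>256 * 32 * 4 * 2\<close>: 256 comes from squaring
    \<open>16 * k^2\<close>, 32 and 4 from \<open>card_exotic_union_at\<close>, and 2 from passing
    to balanced colourings.\<close>
  define c :: real where "c = 1 / (65536 * real k ^ 4 * real k ^ k)"
  have k0: "k > 0" using k by simp
  have c: "c > 0" using k0 by (simp add: c_def)
  have "\<forall>\<^sub>F n in sequentially. c * real n ^ 4 * weight n (colourings n k) \<le> card (exotic_union n k)"
    using eventually_sum_far[OF k0] eventually_ge_at_top[of "4 * k"] weight_balanced[OF k0]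
  proof eventually_elim
    case (elim n)
    have "((real n)\<^sup>2 / (16 * (real k)\<^sup>2))\<^sup>2 * weight n (balanced n k) / 32 \<le> 4 * real k ^ k * card (exotic_union n k)"
      by (rule card_exotic_union_at[OF k elim(2)]) (use elim(1) in blast)
    then have "real n ^ 4 * weight n (balanced n k) \<le> (32768 * real k ^ 4 * real k ^ k) * card (exotic_union n k)"
      using k0 by (simp add: power_divide power_mult_distrib field_simps flip: power_mult)
    moreover have "real n ^ 4 * weight n (colourings n k) \<le> real n ^ 4 * (2 * weight n (balanced n k))"
      using elim(3) by (intro mult_left_mono) auto
    ultimately have "real n ^ 4 * weight n (colourings n k) \<le> (65536 * real k ^ 4 * real k ^ k) * card (exotic_union n k)"
      by linarith
    then show ?case using k0 by (simp add: c_def field_simps)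
  qed
  with c show ?thesis by (rule that)
qed

subsection \<open>Counting graphs with a clean profile\<close>

definition small_class_pairs :: "nat \<Rightarrow> nat \<Rightarrow> (nat \<Rightarrow> nat) \<Rightarrow> nat set set" where
  "small_class_pairs n k p = (\<Union>i\<in>{i. i < k \<and> card (colour_class n p i) < 4}. nsets (colour_class n p i) 2)"

text \<open>A generous superset: the edge need not lie inside a class, nor the centre
  \<open>w\<close> in class \<open>i\<close>. Only its quadratic size matters.\<close>

definition edge_or_star :: "nat \<Rightarrow> nat \<Rightarrow> (nat \<Rightarrow> nat) \<Rightarrow> nat set set set" where
  "edge_or_star n k p = insert {} ((\<lambda>e. {e}) ` nsets {1..n} 2 \<union>
     (\<lambda>(i,w). {{w,z} |z. z \<in> colour_class n p i - {w}}) ` ({..<k} \<times> {1..n}))"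

definition near_partite :: "nat \<Rightarrow> nat \<Rightarrow> nat set set set" where
  "near_partite n k = {E. E \<subseteq> nsets {1..n} 2 \<and> (\<exists>p\<in>colourings n k. \<exists>A\<subseteq>small_class_pairs n k p. \<exists>B\<in>edge_or_star n k p.
     E \<inter> inner_pairs n p = A \<union> B)}"

lemma finite_small_class_pairs [simp]: "finite (small_class_pairs n k p)"
  by (simp add: small_class_pairs_def finite_imp_finite_nsets)

lemma finite_edge_or_star [simp]: "finite (edge_or_star n k p)"
  by (simp add: edge_or_star_def finite_imp_finite_nsets)

lemma card_small_class_pairs: "card (small_class_pairs n k p) \<le> 3 * k"
proof -
  have "card (small_class_pairs n k p) \<le> (\<Sum>i\<in>{i. i < k \<and> card (colour_class n p i) < 4}. card (nsets (colour_class n p i) 2))"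
    unfolding small_class_pairs_def by (rule card_UN_le) simp
  also have "\<dots> \<le> (\<Sum>i\<in>{i. i < k \<and> card (colour_class n p i) < 4}. 3)"
  proof (rule sum_mono)
    fix i assume "i \<in> {i. i < k \<and> card (colour_class n p i) < 4}"
    then have c: "card (colour_class n p i) \<le> 3" by simp
    then have "(card (colour_class n p i))\<^sup>2 \<le> 3 * card (colour_class n p i)" by (simp add: power2_eq_square)
    then show "card (nsets (colour_class n p i) 2) \<le> 3" using two_choose_two[of "card (colour_class n p i)"] c by simp
  qed
  also have "\<dots> \<le> (\<Sum>i<k. 3)" by (rule sum_mono2) auto
  finally show ?thesis by simp
qed

lemma card_edge_or_star: "card (edge_or_star n k p) \<le> 1 + n\<^sup>2 + k * n"
proof -
  have "card ((\<lambda>e. {e}) ` nsets {1..n} 2) \<le> n choose 2"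
    using card_image_le[of "nsets {1..n} 2" "\<lambda>e. {e}"] by (simp add: finite_imp_finite_nsets)
  also have "\<dots> \<le> n\<^sup>2" using two_choose_two[of n] by linarith
  finally have 1: "card ((\<lambda>e. {e}) ` nsets {1..n} 2) \<le> n\<^sup>2" .
  let ?Y = "(\<lambda>(i,w). {{w,z} |z. z \<in> colour_class n p i - {w}}) ` ({..<k} \<times> {1..n})"
  have "card ?Y \<le> card ({..<k} \<times> {1..n})" by (rule card_image_le) simp
  then have 2: "card ?Y \<le> k * n" by (simp add: card_cartesian_product)
  have "card (edge_or_star n k p) \<le> 1 + card ((\<lambda>e. {e}) ` nsets {1..n} 2 \<union> ?Y)"
    unfolding edge_or_star_def by (simp add: card_insert_if finite_imp_finite_nsets)
  also have "\<dots> \<le> 1 + (card ((\<lambda>e. {e}) ` nsets {1..n} 2) + card ?Y)"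
    by (intro add_left_mono card_Un_le)
  also have "\<dots> \<le> 1 + n\<^sup>2 + k * n" using 1 2 by linarith
  finally show ?thesis .
qed

text \<open>Classes with at most three vertices have at most \<open>3 * k\<close> inner pairs
  altogether, and \<open>8^k = 2^(3k)\<close> bounds the choices among them.\<close>

lemma card_near_partite:
  "real (card (near_partite n k)) \<le> 8 ^ k * (1 + real n ^ 2 + k * n) * weight n (colourings n k)"
proof -
  let ?f = "\<lambda>(X,A,B). X \<union> (A \<union> B)"
  let ?S = "\<lambda>p. Pow (cross_pairs n p) \<times> Pow (small_class_pairs n k p) \<times> edge_or_star n k p"
  have "near_partite n k \<subseteq> (\<Union>p\<in>colourings n k. ?f ` ?S p)"
  proof
    fix E assume "E \<in> near_partite n k"
    then obtain p A B where E: "E \<subseteq> nsets {1..n} 2" "p \<in> colourings n k" "A \<subseteq> small_class_pairs n k p"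
      "B \<in> edge_or_star n k p" "E \<inter> inner_pairs n p = A \<union> B" unfolding near_partite_def by blast
    have "E = E \<inter> cross_pairs n p \<union> E \<inter> inner_pairs n p" using E(1) cross_Un_inner_pairs(1)[of n p] by blast
    then have "E = ?f (E \<inter> cross_pairs n p, A, B)" using E(5) by simp
    then show "E \<in> (\<Union>p\<in>colourings n k. ?f ` ?S p)" using E(2-4) by blast
  qed
  then have "card (near_partite n k) \<le> card (\<Union>p\<in>colourings n k. ?f ` ?S p)" by (rule card_mono[rotated]) auto
  also have "\<dots> \<le> (\<Sum>p\<in>colourings n k. card (?f ` ?S p))" by (rule card_UN_le) simp
  also have "\<dots> \<le> (\<Sum>p\<in>colourings n k. 2 ^ card (cross_pairs n p) * (8 ^ k * (1 + n\<^sup>2 + k * n)))"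
  proof (rule sum_mono)
    fix p
    have "card (?f ` ?S p) \<le> card (?S p)" by (rule card_image_le) simp
    also have "\<dots> = 2 ^ card (cross_pairs n p) * (2 ^ card (small_class_pairs n k p) * card (edge_or_star n k p))"
      by (simp add: card_cartesian_product card_Pow)
    also have "\<dots> \<le> 2 ^ card (cross_pairs n p) * (2 ^ (3 * k) * (1 + n\<^sup>2 + k * n))"
      by (intro mult_left_mono mult_mono power_increasing card_small_class_pairs card_edge_or_star) auto
    finally show "card (?f ` ?S p) \<le> 2 ^ card (cross_pairs n p) * (8 ^ k * (1 + n\<^sup>2 + k * n))" by (simp add: power_mult)
  qed
  finally have "real (card (near_partite n k)) \<le> real (\<Sum>p\<in>colourings n k. 2 ^ card (cross_pairs n p) * (8 ^ k * (1 + n\<^sup>2 + k * n)))"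
    by (simp only: of_nat_le_iff)
  also have "\<dots> = weight n (colourings n k) * (8 ^ k * (1 + real n ^ 2 + k * n))"
    unfolding weight_def sum_distrib_right of_nat_sum by (rule sum.cong) (simp_all add: algebra_simps)
  finally show ?thesis by (simp only: mult_ac)
qed

lemma weight_colourings_pos: "k > 0 \<Longrightarrow> weight n (colourings n k) > 0"
  unfolding weight_def by (rule sum_pos[OF finite_colourings]) (auto simp: colourings_def PiE_eq_empty_iff)

text \<open>Both bounds contain the same weight, which cancels and leaves a quadratic over a quartic
  in \<open>n\<close>; the weight itself never has to be estimated.\<close>

lemma near_partite_negligible:
  assumes k: "2 \<le> k" and le: "\<And>n. card (A n) \<le> card (near_partite n k)" "\<And>n. card (exotic_union n k) \<le> card (B n)"
  shows "(\<lambda>n. real (card (A n)) / real (card (B n))) \<longlonglongrightarrow> 0" "\<forall>\<^sub>F n in sequentially. card (B n) > 0"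
proof -
  have k0: "k > 0" using k by simp
  obtain c :: real where c: "c > 0"
    "\<forall>\<^sub>F n in sequentially. c * real n ^ 4 * weight n (colourings n k) \<le> card (exotic_union n k)"
    using eventually_card_exotic_union[OF k] by blast
  define h where "h n = 8 ^ k * (1 + real n ^ 2 + real k * real n) / (c * real n ^ 4)" for n :: nat
  have ev: "\<forall>\<^sub>F n in sequentially. card (B n) > 0 \<and> real (card (A n)) / real (card (B n)) \<le> h n"
    using c(2) eventually_gt_at_top[of 0]
  proof eventually_elim
    case (elim n)
    let ?W = "weight n (colourings n k)"
    have W: "?W > 0" by (rule weight_colourings_pos[OF k0])
    have "0 < c * real n ^ 4 * ?W" using c(1) elim(2) W by simp
    moreover have B: "c * real n ^ 4 * ?W \<le> real (card (B n))" using elim(1) le(2)[of n] by linarith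
    ultimately have B0: "real (card (B n)) > 0" by linarith
    have "real (card (A n)) \<le> 8 ^ k * (1 + real n ^ 2 + k * n) * ?W"
      using le(1)[of n] card_near_partite[of n k] by linarith
    then have "real (card (A n)) / real (card (B n)) \<le> (8 ^ k * (1 + real n ^ 2 + k * n) * ?W) / (c * real n ^ 4 * ?W)"
      using B \<open>0 < c * real n ^ 4 * ?W\<close> by (intro frac_le) auto
    also have "\<dots> = h n" using W by (simp add: h_def)
    finally show ?case using B0 by simp
  qed
  show "\<forall>\<^sub>F n in sequentially. card (B n) > 0" using ev by eventually_elim simp
  have "h \<longlonglongrightarrow> 0" unfolding h_def using c(1) by real_asymp
  then show "(\<lambda>n. real (card (A n)) / real (card (B n))) \<longlonglongrightarrow> 0"
    by (rule tendsto_sandwich[OF _ _ tendsto_const, rotated 2]) (use ev in \<open>auto elim: eventually_mono\<close>)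
qed

subsection \<open>Almost all graphs have no clean profile\<close>

lemma wf_graph_edges_nsets: "wf_graph G \<Longrightarrow> edges G \<subseteq> nsets (verts G) 2"
  by (auto simp: wf_graph_def nsets_def intro: finite_subset)

text \<open>Classes with fewer than four vertices are unrestricted and contribute to
  \<open>A\<close>. At most one larger class has edges, by \<open>two_parts_with_edges\<close>, and
  these form \<open>B\<close>.\<close>

lemma clean_profile_near_partite:
  assumes cl: "clean_profile pat (dense_graph m) G" and V: "verts G = {1..n}"
  shows "edges G \<in> near_partite n (6 + m)"
proof -
  interpret clean_dense_pattern m pat
    using cl by unfold_locales (simp add: clean_profile_def)
  let ?k = "6 + m"
  obtain p0 where wf: "wf_graph G" and p0: "pattern_partition pat G p0"
    using cl by (auto simp: clean_profile_def Pat_def)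
  define p where "p = restrict p0 {1..n}"
  let ?C = "colour_class n p"
  define K where "K i = induced G (?C i)" for i
  have p: "p \<in> colourings n ?k"
    using p0 unfolding pattern_partition_def V length_pat by (auto simp: p_def colourings_def)
  have Kmem: "K i \<in> pat ! i" if "i < ?k" for i
  proof -
    have "{v \<in> verts G. p0 v = i} = ?C i" by (auto simp: colour_class_def V p_def)
    then show ?thesis using p0 that unfolding pattern_partition_def length_pat K_def by metis
  qed
  have CV: "?C i \<subseteq> {1..n}" for i by (auto simp: colour_class_def)
  then have vK: "verts (K i) = ?C i" for i by (auto simp: K_def V)
  have EV: "edges G \<subseteq> nsets {1..n} 2" using wf_graph_edges_nsets[OF wf] V by simp
  have eK: "edges (K i) = {e \<in> edges G. e \<in> nsets (?C i) 2}" for i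
    using EV by (auto simp: K_def nsets_def)
  have inner_eq: "edges G \<inter> inner_pairs n p = (\<Union>i<?k. edges (K i))"
  proof (intro equalityI subsetI)
    fix e assume e: "e \<in> edges G \<inter> inner_pairs n p"
    then obtain i where i: "e \<in> nsets {1..n} 2" "\<forall>v\<in>e. p v = i" by (auto simp: inner_pairs_def)
    then have "e \<noteq> {}" "e \<subseteq> {1..n}" by (auto simp: nsets_def)
    then obtain v where "v \<in> e" "v \<in> {1..n}" by blast
    then have "i < ?k" using i(2) colourings_less[OF p, of v] by auto
    moreover have "e \<in> nsets (?C i) 2" using i by (auto simp: nsets_def colour_class_def)
    ultimately show "e \<in> (\<Union>i<?k. edges (K i))" using e eK by blast
  qed (use eK nsets_colour_class_inner in blast)
  have small: "edges (K i) \<subseteq> small_class_pairs n ?k p" if "i < ?k" "card (?C i) < 4" for i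
    using that eK[of i] unfolding small_class_pairs_def by blast
  have "\<exists>A\<subseteq>small_class_pairs n ?k p. \<exists>B\<in>edge_or_star n ?k p. edges G \<inter> inner_pairs n p = A \<union> B"
  proof (cases "\<exists>i<?k. 4 \<le> card (?C i) \<and> edges (K i) \<noteq> {}")
    case False
    then have "edges G \<inter> inner_pairs n p \<subseteq> small_class_pairs n ?k p" unfolding inner_eq using small by force
    then show ?thesis by (intro exI[of _ "edges G \<inter> inner_pairs n p"] conjI bexI[of _ "{}"]) (auto simp: edge_or_star_def)
  next
    case True
    then obtain i where i: "i < ?k" "4 \<le> card (?C i)" "edges (K i) \<noteq> {}" by blast
    have others: "edges (K j) \<subseteq> small_class_pairs n ?k p" if "j < ?k" "j \<noteq> i" for j
    proof (cases "card (?C j) < 4")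
      case False
      then have "edges (K j) = {}"
        using two_parts_with_edges[OF i(1) Kmem[OF i(1)] _ i(3) that(1) Kmem[OF that(1)]] i(2) that(2) vK by fastforce
      then show ?thesis by simp
    qed (use small that in blast)
    have "edges (K i) \<in> edge_or_star n ?k p"
    proof -
      consider e where "edges (K i) = {e}"
        | w where "w \<in> ?C i" "edges (K i) = {{w,z} |z. z \<in> ?C i - {w}}"
        using part_structure[OF i(1) Kmem[OF i(1)]] i(2,3) unfolding vK by blast
      then show ?thesis
      proof cases
        case (1 e)
        then have "e \<in> nsets {1..n} 2" using eK EV by auto
        then show ?thesis unfolding 1 by (simp add: edge_or_star_def)
      next
        case (2 w)
        have "(i,w) \<in> {..<?k} \<times> {1..n}" using 2(1) CV i(1) by blast
        then show ?thesis unfolding edge_or_star_def 2(2)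
          by (intro insertI2 UnI2) (rule image_eqI[of _ _ "(i,w)"], auto)
      qed
    qed
    moreover have "edges G \<inter> inner_pairs n p = (\<Union>j\<in>{..<?k} - {i}. edges (K j)) \<union> edges (K i)"
      unfolding inner_eq using i(1) by blast
    moreover have "(\<Union>j\<in>{..<?k} - {i}. edges (K j)) \<subseteq> small_class_pairs n ?k p" using others by blast
    ultimately show ?thesis by blast
  qed
  then show ?thesis unfolding near_partite_def using p EV by blast
qed

lemma exotic_union_Forb:
  assumes E: "E \<in> exotic_union n (6 + m)"
  shows "({1..n}, E) \<in> graphs_on n (Forb (dense_graph m))"
proof -
  let ?G = "({1..n}, E) :: graph"
  have vG: "verts ?G = {1..n}" and eG: "edges ?G = E" by (simp_all add: verts_def edges_def)
  obtain p e f where idx: "(p,e,f) \<in> exotic_index n (6 + m)" and ex: "E \<in> exotic n p e f"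
    using E by (auto simp: exotic_union_def)
  have p: "p \<in> colourings n (6 + m)" and e: "e \<in> nsets (colour_class n p 0) 2" and f: "f \<in> nsets (colour_class n p 1) 2"
    using idx balanced_subset by (auto simp: exotic_index_def)
  have ef: "e \<in> inner_pairs n p" "f \<in> inner_pairs n p" using e f nsets_colour_class_inner by blast+
  note inn = exotic_inner[OF ef ex]
  have "wf_graph ?G" unfolding wf_graph_def vG eG using inn(2) by (auto simp: nsets_def)
  moreover have "H_free (dense_graph m) ?G"
  proof (rule exotic_H_free[of ?G p m e f], unfold vG eG)
    show "p v < 6 + m" if "v \<in> {1..n}" for v using colourings_less[OF p that] .
    show "{u,v} = e \<or> {u,v} = f" if "u \<in> {1..n}" "v \<in> {1..n}" "u \<noteq> v" "p u = p v" "{u,v} \<in> E" for u v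
    proof -
      have "{u,v} \<in> E \<inter> inner_pairs n p" using that by (simp add: doubleton_inner_pairs)
      then show ?thesis unfolding inn(1) by blast
    qed
    fix u v assume uv: "u \<in> e" "v \<in> f"
    have puv: "p u = 0" "p v = 1" using uv e f by (auto simp: nsets_def colour_class_def)
    then have "{u,v} \<notin> inner_pairs n p" by (simp add: doubleton_inner_pairs)
    then have "{u,v} \<noteq> e" "{u,v} \<noteq> f" using ef by blast+
    moreover have "{u,v} \<in> pairs_between e f" using uv by (auto simp: pairs_between_def)
    ultimately have "{u,v} \<notin> E" using ex by (auto simp: exotic_def)
    then show "p u \<noteq> p v \<and> {u,v} \<notin> E" using puv by simp
  qed
  ultimately show ?thesis using vG unfolding graphs_on_def Forb_def by blast
qed

lemma finite_graphs_on:
  assumes "F \<subseteq> Collect wf_graph" shows "finite (graphs_on n F)"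
proof (rule finite_subset)
  show "graphs_on n F \<subseteq> {{1..n}} \<times> Pow (nsets {1..n} 2)"
  proof
    fix G assume "G \<in> graphs_on n F"
    then have "verts G = {1..n}" "edges G \<subseteq> nsets {1..n} 2"
      using assms wf_graph_edges_nsets[of G] by (auto simp: graphs_on_def)
    then show "G \<in> {{1..n}} \<times> Pow (nsets {1..n} 2)" by (cases G) (simp add: verts_def edges_def)
  qed
qed (simp add: finite_imp_finite_nsets)

lemma almost_all_no_clean_profile:
  "almost_all (Forb (dense_graph m)) {G. \<not> (\<exists>pat. clean_profile pat (dense_graph m) G)}"
proof -
  let ?H = "dense_graph m" and ?k = "6 + m"
  define B where "B n = graphs_on n (Forb ?H)" for n
  define A where "A n = {G \<in> B n. \<exists>pat. clean_profile pat ?H G}" for n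
  have finB: "finite (B n)" for n unfolding B_def by (rule finite_graphs_on) (auto simp: Forb_def)
  have A_le: "card (A n) \<le> card (near_partite n ?k)" for n
  proof (rule card_inj_on_le[of edges])
    show "inj_on edges (A n)"
    proof (rule inj_onI)
      fix G G' assume "G \<in> A n" "G' \<in> A n" "edges G = edges G'"
      then show "G = G'" by (cases G; cases G') (simp add: A_def B_def graphs_on_def verts_def edges_def)
    qed
    show "edges ` A n \<subseteq> near_partite n ?k"
      using clean_profile_near_partite by (auto simp: A_def B_def graphs_on_def)
    show "finite (near_partite n ?k)" by (rule finite_subset[of _ "Pow (nsets {1..n} 2)"])
      (auto simp: near_partite_def finite_imp_finite_nsets)
  qed
  have B_ge: "card (exotic_union n ?k) \<le> card (B n)" for n
  proof (rule card_inj_on_le[of "\<lambda>E. ({1..n}, E)"])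
    show "(\<lambda>E. ({1..n}, E)) ` exotic_union n ?k \<subseteq> B n"
      using exotic_union_Forb unfolding B_def by blast
  qed (auto simp: inj_on_def finB)
  have lim: "(\<lambda>n. real (card (A n)) / real (card (B n))) \<longlonglongrightarrow> 0"
    and pos: "\<forall>\<^sub>F n in sequentially. card (B n) > 0"
    by (rule near_partite_negligible[OF _ A_le B_ge]; simp)+
  \<comment> \<open>The equation holds only eventually, because the quotient needs
    \<open>B n\<close> to be nonempty.\<close>
  have "\<forall>\<^sub>F n in sequentially. 1 - real (card (A n)) / real (card (B n))
      = real (card (B n \<inter> {G. \<not> (\<exists>pat. clean_profile pat ?H G)})) / real (card (B n))"
    using pos
  proof eventually_elim
    case (elim n)
    have "B n \<inter> {G. \<not> (\<exists>pat. clean_profile pat ?H G)} = B n - A n" by (auto simp: A_def)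
    moreover have "card (B n - A n) = card (B n) - card (A n)" "card (A n) \<le> card (B n)"
      using finB by (auto simp: A_def intro!: card_Diff_subset card_mono)
    ultimately show ?case using elim by (simp add: diff_divide_distrib of_nat_diff)
  qed
  moreover have "(\<lambda>n. 1 - real (card (A n)) / real (card (B n))) \<longlonglongrightarrow> 1"
    using tendsto_diff[OF tendsto_const[of 1] lim] by simp
  ultimately show ?thesis unfolding almost_all_def B_def[symmetric]
    by (rule Lim_transform_eventually[rotated])
qed

lemma graph_iso_card: "graph_iso G H \<Longrightarrow> card (verts G) = card (verts H)"
  by (auto simp: graph_iso_def dest: bij_betw_same_card)

lemma not_iso_dense_graph: "m \<noteq> m' \<Longrightarrow> \<not> graph_iso (dense_graph m) (dense_graph m')"
  using graph_iso_card[of "dense_graph m" "dense_graph m'"] by auto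

theorem theorem1p3:
  shows "\<exists>S::graph set. infinite S \<and>
    (\<forall>H1\<in>S. \<forall>H2\<in>S. H1 \<noteq> H2 \<longrightarrow> \<not> graph_iso H1 H2) \<and>
    (\<forall>H\<in>S. wf_graph H \<and>
       almost_all (Forb H) {G. \<not> (\<exists>pat. clean_profile pat H G)})"
proof (intro exI[of _ "range dense_graph"] conjI)
  have "inj dense_graph"
  proof (rule injI)
    fix m m' assume "dense_graph m = dense_graph m'"
    then have "card (verts (dense_graph m)) = card (verts (dense_graph m'))" by simp
    then show "m = m'" by simp
  qed
  then show "infinite (range dense_graph)" by (rule range_inj_infinite)
  show "\<forall>H1\<in>range dense_graph. \<forall>H2\<in>range dense_graph. H1 \<noteq> H2 \<longrightarrow> \<not> graph_iso H1 H2"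
  proof (intro ballI impI)
    fix H1 H2 assume "H1 \<in> range dense_graph" "H2 \<in> range dense_graph" "H1 \<noteq> H2"
    then obtain m m' where "H1 = dense_graph m" "H2 = dense_graph m'" "m \<noteq> m'" by (elim rangeE) auto
    then show "\<not> graph_iso H1 H2" by (simp only: not_iso_dense_graph not_False_eq_True)
  qed
  show "\<forall>H\<in>range dense_graph. wf_graph H \<and> almost_all (Forb H) {G. \<not> (\<exists>pat. clean_profile pat H G)}"
  proof
    fix H assume "H \<in> range dense_graph"
    then obtain m where "H = dense_graph m" by (elim rangeE)
    then show "wf_graph H \<and> almost_all (Forb H) {G. \<not> (\<exists>pat. clean_profile pat H G)}"
      by (simp only: wf_dense_graph almost_all_no_clean_profile simp_thms)
  qed
qed

end
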